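(* Let $\Omega=\mathbf{R}^d\setminus\{0\}$, so $d_\Omega(x)=|x|$, let $\delta,\delta'\geq0$, $c(s)=s^\delta(1+s)^{\delta'-\delta}$ for $s>0$, $c_\Omega(x)=c(|x|)$, and let $H$ be the corresponding submarkovian operator on $L_2(\Omega)$ defined in the context. Assume $\delta+\delta'\geq4$. If $d-|\delta-\delta'|>0$ then the Rellich inequality $$(H\varphi,H\varphi)\geq a_2\,(c_\Omega d_\Omega^{-2}\varphi,\,c_\Omega d_\Omega^{-2}\varphi)$$ is valid for all $\varphi\in D(H)$ with $a_2=(d-|\delta-\delta'|)^2(d+\delta+\delta'-4)^2/16$.
   Context: $L_2(\Omega)$ is the real $L_2$-space with respect to Lebesgue measure, with inner product $(\cdot,\cdot)$. The form $h$ is the closure of $\varphi\in C_c^\infty(\Omega)\mapsto h(\varphi)=\sum_{k=1}^d(\partial_k\varphi,c_\Omega\,\partial_k\varphi)$, a Dirichlet form with domain $D(h)$, and $H$ is the positive self-adjoint operator associated with $h$ ($D(h)=D(H^{1/2})$, $h(\varphi)=\|H^{1/2}\varphi\|_2^2$). *)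

theory Defs
  imports "HOL-Analysis.Analysis"
begin

text \<open>
  Elements of \<open>L\<^sub>2(\<Omega>)\<close> are represented by functions, not by classes modulo null sets;
  \<open>form_dom\<close>, \<open>closed_form\<close> and \<open>form_operator_dom\<close> are insensitive to changes on null sets.
\<close>

definition L2_space :: "'a::euclidean_space set \<Rightarrow> ('a \<Rightarrow> real) set" where
  "L2_space \<Omega> = {\<phi> \<in> borel_measurable (lebesgue_on \<Omega>).
     integrable (lebesgue_on \<Omega>) (\<lambda>x. (\<phi> x)\<^sup>2)}"

definition L2_inner :: "'a::euclidean_space set \<Rightarrow> ('a \<Rightarrow> real) \<Rightarrow> ('a \<Rightarrow> real) \<Rightarrow> real" where
  "L2_inner \<Omega> \<phi> \<psi> = (\<integral>x. \<phi> x * \<psi> x \<partial>(lebesgue_on \<Omega>))"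

definition L2_norm :: "'a::euclidean_space set \<Rightarrow> ('a \<Rightarrow> real) \<Rightarrow> real" where
  "L2_norm \<Omega> \<phi> = sqrt (L2_inner \<Omega> \<phi> \<phi>)"

definition partial :: "'a::euclidean_space \<Rightarrow> ('a \<Rightarrow> real) \<Rightarrow> 'a \<Rightarrow> real" where
  "partial b \<phi> x = frechet_derivative \<phi> (at x) b"

primrec C_k :: "nat \<Rightarrow> ('a::euclidean_space \<Rightarrow> real) \<Rightarrow> bool" where
  "C_k 0 \<phi> \<longleftrightarrow> continuous_on UNIV \<phi>"
| "C_k (Suc k) \<phi> \<longleftrightarrow> (\<forall>x. \<phi> differentiable (at x)) \<and> (\<forall>b\<in>Basis. C_k k (partial b \<phi>))"

text \<open>\<open>C\<^sub>c\<^sup>\<infinity>(\<Omega>)\<close>, each function being extended by zero to the whole space.\<close>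

definition test_functions :: "'a::euclidean_space set \<Rightarrow> ('a \<Rightarrow> real) set" where
  "test_functions \<Omega> = {\<phi>. (\<forall>k. C_k k \<phi>) \<and>
     compact (closure {x. \<phi> x \<noteq> 0}) \<and> closure {x. \<phi> x \<noteq> 0} \<subseteq> \<Omega>}"

definition core_form :: "'a::euclidean_space set \<Rightarrow> ('a \<Rightarrow> real) \<Rightarrow> ('a \<Rightarrow> real) \<Rightarrow> real" where
  "core_form \<Omega> c \<phi> = (\<Sum>b\<in>Basis. L2_inner \<Omega> (partial b \<phi>) (\<lambda>x. c x * partial b \<phi> x))"

text \<open>Form convergence of a sequence of test functions to an element of \<open>L\<^sub>2(\<Omega>)\<close>.\<close>

definition form_approx ::
    "'a::euclidean_space set \<Rightarrow> ('a \<Rightarrow> real) \<Rightarrow> (nat \<Rightarrow> 'a \<Rightarrow> real) \<Rightarrow> ('a \<Rightarrow> real) \<Rightarrow> bool" where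
  "form_approx \<Omega> c \<Phi> \<phi> \<longleftrightarrow>
     (\<forall>n. \<Phi> n \<in> test_functions \<Omega>) \<and>
     (\<lambda>n. L2_norm \<Omega> (\<lambda>x. \<Phi> n x - \<phi> x)) \<longlonglongrightarrow> 0 \<and>
     (\<forall>e>0. \<exists>N. \<forall>m\<ge>N. \<forall>n\<ge>N. core_form \<Omega> c (\<lambda>x. \<Phi> m x - \<Phi> n x) < e)"

definition form_dom :: "'a::euclidean_space set \<Rightarrow> ('a \<Rightarrow> real) \<Rightarrow> ('a \<Rightarrow> real) set" where
  "form_dom \<Omega> c = {\<phi> \<in> L2_space \<Omega>. \<exists>\<Phi>. form_approx \<Omega> c \<Phi> \<phi>}"

text \<open>The limit is independent of the approximating sequence because the form is closable.\<close>

definition closed_form :: "'a::euclidean_space set \<Rightarrow> ('a \<Rightarrow> real) \<Rightarrow> ('a \<Rightarrow> real) \<Rightarrow> real" where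
  "closed_form \<Omega> c \<phi> =
     (THE l. \<exists>\<Phi>. form_approx \<Omega> c \<Phi> \<phi> \<and> (\<lambda>n. core_form \<Omega> c (\<Phi> n)) \<longlonglongrightarrow> l)"

definition closed_bilinear ::
    "'a::euclidean_space set \<Rightarrow> ('a \<Rightarrow> real) \<Rightarrow> ('a \<Rightarrow> real) \<Rightarrow> ('a \<Rightarrow> real) \<Rightarrow> real" where
  "closed_bilinear \<Omega> c \<phi> \<psi> =
     (closed_form \<Omega> c (\<lambda>x. \<phi> x + \<psi> x) - closed_form \<Omega> c (\<lambda>x. \<phi> x - \<psi> x)) / 4"

text \<open>
  The operator \<open>H\<close> associated with the closed form \<open>h\<close> in the sense of the first representation
  theorem: \<open>H\<phi> = \<eta>\<close> iff \<open>\<phi> \<in> D(h)\<close>, \<open>\<eta> \<in> L\<^sub>2(\<Omega>)\<close> and \<open>h(\<phi>, \<psi>) = (\<eta>, \<psi>)\<close> for all \<open>\<psi> \<in> D(h)\<close>.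
  This is the unique positive self-adjoint operator with \<open>D(H\<^sup>1\<^sup>/\<^sup>2) = D(h)\<close> and
  \<open>h(\<phi>) = \<parallel>H\<^sup>1\<^sup>/\<^sup>2\<phi>\<parallel>\<^sup>2\<close>. The function \<open>\<eta>\<close> is determined up to a null set.
\<close>

definition form_operator_rel ::
    "'a::euclidean_space set \<Rightarrow> ('a \<Rightarrow> real) \<Rightarrow> ('a \<Rightarrow> real) \<Rightarrow> ('a \<Rightarrow> real) \<Rightarrow> bool" where
  "form_operator_rel \<Omega> c \<phi> \<eta> \<longleftrightarrow> \<phi> \<in> form_dom \<Omega> c \<and> \<eta> \<in> L2_space \<Omega> \<and>
     (\<forall>\<psi>\<in>form_dom \<Omega> c. closed_bilinear \<Omega> c \<phi> \<psi> = L2_inner \<Omega> \<eta> \<psi>)"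

definition form_operator_dom :: "'a::euclidean_space set \<Rightarrow> ('a \<Rightarrow> real) \<Rightarrow> ('a \<Rightarrow> real) set" where
  "form_operator_dom \<Omega> c = {\<phi>. \<exists>\<eta>. form_operator_rel \<Omega> c \<phi> \<eta>}"

definition form_operator ::
    "'a::euclidean_space set \<Rightarrow> ('a \<Rightarrow> real) \<Rightarrow> ('a \<Rightarrow> real) \<Rightarrow> ('a \<Rightarrow> real)" where
  "form_operator \<Omega> c \<phi> = (SOME \<eta>. form_operator_rel \<Omega> c \<phi> \<eta>)"

end

theory Submission
  imports Defs
begin

text \<open>
  Put \<open>w\<^sup>2 = c\<^sub>\<Omega> d\<^sub>\<Omega>\<^sup>-\<^sup>2\<close>. Formally \<open>(H\<phi>, w\<^sup>2\<phi>) = h(w\<phi>) - (\<phi>, c\<^sub>\<Omega> \<bar>\<nabla>w\<bar>\<^sup>2 \<phi>)\<close>, and the weighted Hardy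
  inequality for \<open>w\<phi>\<close> gives \<open>(H\<phi>, w\<^sup>2\<phi>) \<ge> K \<parallel>w\<^sup>2\<phi>\<parallel>\<^sup>2\<close> with \<open>K\<^sup>2 = a\<^sub>2\<close>, so that Cauchy-Schwarz yields
  \<open>K \<parallel>w\<^sup>2\<phi>\<parallel> \<le> \<parallel>H\<phi>\<parallel>\<close>. To make this rigorous \<open>w\<^sup>2\<close> is replaced by the bounded multiplier
  \<open>q = w\<^sup>2 / (1 + \<epsilon> w\<^sup>2)\<close>. Its logarithmic slope is dominated by that of \<open>w\<^sup>2\<close>, so the constant \<open>K\<close>
  survives; multiplication by \<open>q\<close> preserves the form domain; and \<open>q\<close> increases to \<open>w\<^sup>2\<close> as
  \<open>\<epsilon>\<close> decreases to \<open>0\<close>.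
\<close>

section \<open>Semi-inner products\<close>

text \<open>The obstacle is that w^2 \<phi> is not known to lie in L2, still less in D(h), so the
  final division by its norm would be circular. With a bounded multiplier \<open>q\<close>, q \<phi>
  is an admissible second argument in h(\<phi>, \<psi>) = (H \<phi>, \<psi>) and has finite norm.
  This \<open>q\<close>, unlike the minimum of w^2 and 1/\<epsilon>, is smooth off the origin, so it
  maps test functions to test functions, and differential identities are needed only for these.
  Origin of the constant: put r = |x|, e = r c'/c and \<sigma> = (e + d - 2)/2. Completing a square
  leaves \<sigma>^2 - ((e - 2)/2)^2 + r \<sigma>' = d (d + 2e - 4)/4 + r \<sigma>'. As r runs from 0
  to infinity, e runs from \<delta> to \<delta>'. The end with the smaller e gives d (d + 2
  min(\<delta>, \<delta>') - 4)/4, which is K plus |\<delta> - \<delta>'| (\<delta> + \<delta>' -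
  4)/4; this is where \<delta> + \<delta>' >= 4 enters. The condition d > |\<delta> - \<delta>'|
  makes K positive. The closed form is a limit, so inequalities reach D(h) only along approximating
  sequences. This calls for closability, which holds because h(f, .) is L2-bounded for each test
  function f.\<close>

locale semi_inner =
  fixes V :: "('b \<Rightarrow> real) set" and B :: "('b \<Rightarrow> real) \<Rightarrow> ('b \<Rightarrow> real) \<Rightarrow> real"
  assumes lin: "\<And>f g a. f \<in> V \<Longrightarrow> g \<in> V \<Longrightarrow> (\<lambda>x. f x + a * g x) \<in> V"
    and B_lin: "\<And>f g h a. f \<in> V \<Longrightarrow> g \<in> V \<Longrightarrow> h \<in> V \<Longrightarrow>
      B (\<lambda>x. f x + a * g x) h = B f h + a * B g h"
    and B_sym: "\<And>f g. B f g = B g f"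
    and B_nonneg: "\<And>f. f \<in> V \<Longrightarrow> 0 \<le> B f f"
begin

lemma B_lin_right: "f \<in> V \<Longrightarrow> g \<in> V \<Longrightarrow> h \<in> V \<Longrightarrow>
    B h (\<lambda>x. f x + a * g x) = B h f + a * B h g"
  by (simp add: B_sym[of h] B_lin)

lemma B_quadratic:
  assumes "f \<in> V" "g \<in> V"
  shows "B (\<lambda>x. f x + a * g x) (\<lambda>x. f x + a * g x) = B f f + 2 * a * B f g + a\<^sup>2 * B g g"
  using assms by (simp add: B_lin B_lin_right lin B_sym[of g f] power2_eq_square algebra_simps)

lemma diff_closed: "f \<in> V \<Longrightarrow> g \<in> V \<Longrightarrow> (\<lambda>x. f x - g x) \<in> V"
  using lin[of f g "-1"] by simp

lemma B_diff_right: "f \<in> V \<Longrightarrow> g \<in> V \<Longrightarrow> h \<in> V \<Longrightarrow>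
    B h (\<lambda>x. f x - g x) = B h f - B h g"
  using B_lin_right[of f g h "-1"] by simp

lemma Cauchy_Schwarz_sq:
  assumes f: "f \<in> V" and g: "g \<in> V"
  shows "(B f g)\<^sup>2 \<le> B f f * B g g"
proof (cases "B g g = 0")
  case True
  have "B f g = 0"
  proof (rule ccontr)
    assume "B f g \<noteq> 0"
    \<comment> \<open>A null vector \<open>g\<close> need not be the zero function. If
      \<open>B f g\<close> were nonzero, this multiple of \<open>g\<close> would bring the quadratic
      in \<open>a\<close> down to -1.\<close>
    then have "B f f + 2 * (- (B f f + 1) / (2 * B f g)) * B f g = -1" by (simp add: field_simps)
    then show False
      using B_quadratic[OF f g, of "- (B f f + 1) / (2 * B f g)"] True
        B_nonneg[OF lin[OF f g, of "- (B f f + 1) / (2 * B f g)"]] by simp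
  qed
  then show ?thesis using True by simp
next
  case False
  then have pos: "B g g > 0" using B_nonneg[OF g] by simp
  \<comment> \<open>The coefficient of \<open>g\<close> is the minimiser of the quadratic in
    \<open>a\<close>.\<close>
  have "0 \<le> B f f + 2 * (- B f g / B g g) * B f g + (- B f g / B g g)\<^sup>2 * B g g"
    using B_quadratic[OF f g, of "- B f g / B g g"] B_nonneg[OF lin[OF f g, of "- B f g / B g g"]]
    by linarith
  also have "\<dots> = B f f - (B f g)\<^sup>2 / B g g"
    using pos by (simp add: field_simps power2_eq_square)
  finally show ?thesis using pos by (simp add: field_simps)
qed

lemma Cauchy_Schwarz:
  assumes "f \<in> V" "g \<in> V"
  shows "\<bar>B f g\<bar> \<le> sqrt (B f f) * sqrt (B g g)"
  using real_sqrt_le_mono[OF Cauchy_Schwarz_sq[OF assms]] by (simp add: real_sqrt_mult)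

lemma triangle:
  assumes f: "f \<in> V" and g: "g \<in> V"
  shows "sqrt (B (\<lambda>x. f x + a * g x) (\<lambda>x. f x + a * g x)) \<le> sqrt (B f f) + \<bar>a\<bar> * sqrt (B g g)"
proof -
  have "a * B f g \<le> \<bar>a\<bar> * (sqrt (B f f) * sqrt (B g g))"
    using mult_left_mono[OF Cauchy_Schwarz[OF assms], of "\<bar>a\<bar>"] abs_ge_self[of "a * B f g"]
    by (simp add: abs_mult)
  then have "B (\<lambda>x. f x + a * g x) (\<lambda>x. f x + a * g x)
      \<le> B f f + 2 * (\<bar>a\<bar> * (sqrt (B f f) * sqrt (B g g))) + a\<^sup>2 * B g g"
    unfolding B_quadratic[OF f g] by linarith
  also have "\<dots> = (sqrt (B f f) + \<bar>a\<bar> * sqrt (B g g))\<^sup>2"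
    using B_nonneg[OF f] B_nonneg[OF g] by (simp add: power2_sum power_mult_distrib)
  finally show ?thesis
    using B_nonneg[OF f] B_nonneg[OF g] by (intro real_le_lsqrt) auto
qed

lemma triangle_add:
  assumes "f \<in> V" "g \<in> V"
  shows "sqrt (B (\<lambda>x. f x + g x) (\<lambda>x. f x + g x)) \<le> sqrt (B f f) + sqrt (B g g)"
  using triangle[OF assms, of 1] by simp

lemma triangle_diff:
  assumes "f \<in> V" "g \<in> V"
  shows "sqrt (B (\<lambda>x. f x - g x) (\<lambda>x. f x - g x)) \<le> sqrt (B f f) + sqrt (B g g)"
  using triangle[OF assms, of "-1"] by simp

lemma B_diff_swap:
  assumes "f \<in> V" "g \<in> V"
  shows "B (\<lambda>x. f x - g x) (\<lambda>x. f x - g x) = B (\<lambda>x. g x - f x) (\<lambda>x. g x - f x)"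
  using B_quadratic[OF assms, of "-1"] B_quadratic[OF assms(2,1), of "-1"] B_sym[of f g] by simp

lemma reverse_triangle:
  assumes f: "f \<in> V" and g: "g \<in> V"
  shows "\<bar>sqrt (B f f) - sqrt (B g g)\<bar> \<le> sqrt (B (\<lambda>x. f x - g x) (\<lambda>x. f x - g x))"
  using triangle_add[OF diff_closed[OF f g] g] triangle_add[OF diff_closed[OF g f] f]
    B_diff_swap[OF f g] by simp

text \<open>By the reverse triangle inequality a perturbation of vanishing seminorm does not change
  the limit. This makes the closed form independent of the approximating sequence.\<close>

lemma tendsto_norm:
  assumes f: "\<And>n. f n \<in> V" and g: "\<And>n. g n \<in> V"
    and lim: "(\<lambda>n. sqrt (B (\<lambda>x. f n x - g n x) (\<lambda>x. f n x - g n x))) \<longlonglongrightarrow> 0"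
    and l: "(\<lambda>n. B (g n) (g n)) \<longlonglongrightarrow> l"
  shows "(\<lambda>n. B (f n) (f n)) \<longlonglongrightarrow> l"
proof -
  have "(\<lambda>n. sqrt (B (f n) (f n)) - sqrt (B (g n) (g n))) \<longlonglongrightarrow> 0"
    using reverse_triangle[OF f g]
    by (intro tendsto_rabs_zero_cancel[OF tendsto_sandwich[OF _ _ tendsto_const lim]]) auto
  then have "(\<lambda>n. sqrt (B (f n) (f n)) - sqrt (B (g n) (g n)) + sqrt (B (g n) (g n))) \<longlonglongrightarrow> 0 + sqrt l"
    by (intro tendsto_add tendsto_real_sqrt l)
  then have "(\<lambda>n. (sqrt (B (f n) (f n)))\<^sup>2) \<longlonglongrightarrow> (sqrt l)\<^sup>2"
    by (intro tendsto_power) simp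
  moreover have "0 \<le> l"
    using B_nonneg[OF g] by (intro LIMSEQ_le_const[OF l]) auto
  ultimately show ?thesis using B_nonneg[OF f] by simp
qed

text \<open>The seminorms form a Cauchy sequence of reals by the reverse triangle inequality;
  completeness is used in the reals, not in \<open>V\<close>.\<close>

lemma Cauchy_convergent:
  assumes f: "\<And>n. f n \<in> V"
    and cauchy: "\<And>e. e > 0 \<Longrightarrow> \<exists>N. \<forall>m\<ge>N. \<forall>n\<ge>N. B (\<lambda>x. f m x - f n x) (\<lambda>x. f m x - f n x) < e"
  shows "\<exists>l. (\<lambda>n. B (f n) (f n)) \<longlonglongrightarrow> l"
proof -
  have "Cauchy (\<lambda>n. sqrt (B (f n) (f n)))"
  proof (rule metric_CauchyI)
    fix e :: real assume e: "0 < e"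
    obtain N where N: "\<And>m n. m \<ge> N \<Longrightarrow> n \<ge> N \<Longrightarrow> B (\<lambda>x. f m x - f n x) (\<lambda>x. f m x - f n x) < e\<^sup>2"
      using cauchy[of "e\<^sup>2"] e by auto
    have "dist (sqrt (B (f m) (f m))) (sqrt (B (f n) (f n))) < e" if "m \<ge> N" "n \<ge> N" for m n
      using reverse_triangle[OF f f, of m n] real_less_lsqrt[OF _ N[OF that]] e
      by (simp add: dist_real_def)
    then show "\<exists>M. \<forall>m\<ge>M. \<forall>n\<ge>M. dist (sqrt (B (f m) (f m))) (sqrt (B (f n) (f n))) < e" by blast
  qed
  then obtain l where "(\<lambda>n. sqrt (B (f n) (f n))) \<longlonglongrightarrow> l"
    using Cauchy_convergent_iff convergent_def by blast
  then have "(\<lambda>n. (sqrt (B (f n) (f n)))\<^sup>2) \<longlonglongrightarrow> l\<^sup>2" by (intro tendsto_power)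
  then show ?thesis using B_nonneg[OF f] by auto
qed

end

section \<open>The space \<open>L\<^sub>2\<close>\<close>

lemma L2_integrable_mult:
  assumes "f \<in> L2_space S" "g \<in> L2_space S"
  shows "integrable (lebesgue_on S) (\<lambda>x. f x * g x)"
proof (rule Bochner_Integration.integrable_bound)
  show "integrable (lebesgue_on S) (\<lambda>x. (f x)\<^sup>2 + (g x)\<^sup>2)"
    using assms by (auto simp: L2_space_def)
  show "(\<lambda>x. f x * g x) \<in> borel_measurable (lebesgue_on S)"
    using assms by (auto simp: L2_space_def)
  have "\<bar>a * b\<bar> \<le> a\<^sup>2 + b\<^sup>2" for a b :: real
  proof -
    have "2 * \<bar>a * b\<bar> \<le> a\<^sup>2 + b\<^sup>2"
      using sum_squares_bound[of "\<bar>a\<bar>" "\<bar>b\<bar>"] by (simp add: abs_mult)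
    then show ?thesis by linarith
  qed
  then show "AE x in lebesgue_on S. norm (f x * g x) \<le> norm ((f x)\<^sup>2 + (g x)\<^sup>2)" by simp
qed

lemma L2_lin:
  assumes f: "f \<in> L2_space S" and g: "g \<in> L2_space S"
  shows "(\<lambda>x. f x + a * g x) \<in> L2_space S"
proof -
  have "integrable (lebesgue_on S) (\<lambda>x. (f x)\<^sup>2 + 2 * a * (f x * g x) + a\<^sup>2 * (g x)\<^sup>2)"
    using assms L2_integrable_mult[OF f g] by (auto simp: L2_space_def)
  then have "integrable (lebesgue_on S) (\<lambda>x. (f x + a * g x)\<^sup>2)"
    by (rule back_subst[of "integrable (lebesgue_on S)"]) (auto simp: power2_eq_square algebra_simps)
  then show ?thesis using assms by (auto simp: L2_space_def)
qed

interpretation L2: semi_inner "L2_space S" "L2_inner S" for S :: "'a::euclidean_space set"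
proof
  fix f g h :: "'a \<Rightarrow> real" and a :: real
  show "L2_inner S f g = L2_inner S g f"
    by (simp add: L2_inner_def mult.commute)
  show "0 \<le> L2_inner S f f"
    unfolding L2_inner_def by (rule integral_nonneg_AE) simp
  assume f: "f \<in> L2_space S" and g: "g \<in> L2_space S"
  show "(\<lambda>x. f x + a * g x) \<in> L2_space S" by (rule L2_lin[OF f g])
  assume h: "h \<in> L2_space S"
  show "L2_inner S (\<lambda>x. f x + a * g x) h = L2_inner S f h + a * L2_inner S g h"
    using L2_integrable_mult[OF f h] L2_integrable_mult[OF g h]
    by (simp add: L2_inner_def distrib_right mult.assoc)
qed

lemma
  assumes f: "f \<in> L2_space S" and q: "q \<in> borel_measurable (lebesgue_on S)"
    and M: "\<And>x. x \<in> S \<Longrightarrow> \<bar>q x\<bar> \<le> M" "0 \<le> M"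
  shows L2_bounded_mult: "(\<lambda>x. q x * f x) \<in> L2_space S"
    and L2_norm_bounded_mult: "L2_norm S (\<lambda>x. q x * f x) \<le> M * L2_norm S f"
proof -
  have le: "(q x * f x)\<^sup>2 \<le> M\<^sup>2 * (f x)\<^sup>2" if "x \<in> S" for x
    using mult_right_mono[OF power_mono[OF M(1)[OF that] abs_ge_zero, of 2], of "(f x)\<^sup>2"]
    by (simp add: power_mult_distrib)
  have int: "integrable (lebesgue_on S) (\<lambda>x. M\<^sup>2 * (f x)\<^sup>2)"
    using f by (auto simp: L2_space_def)
  have qf: "(\<lambda>x. q x * f x) \<in> borel_measurable (lebesgue_on S)"
    using f q by (auto simp: L2_space_def)
  have int2: "integrable (lebesgue_on S) (\<lambda>x. (q x * f x)\<^sup>2)"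
    using le qf by (intro Bochner_Integration.integrable_bound[OF int]) auto
  show "(\<lambda>x. q x * f x) \<in> L2_space S"
    using int2 qf by (simp add: L2_space_def)
  have "L2_inner S (\<lambda>x. q x * f x) (\<lambda>x. q x * f x) \<le> M\<^sup>2 * L2_inner S f f"
    using integral_mono[OF int2 int] le by (simp add: L2_inner_def power2_eq_square mult_ac)
  from real_sqrt_le_mono[OF this] show "L2_norm S (\<lambda>x. q x * f x) \<le> M * L2_norm S f"
    using M by (simp add: L2_norm_def real_sqrt_mult)
qed

section \<open>Test functions on the punctured space\<close>

lemma partial_eqI: "(f has_derivative f') (at x) \<Longrightarrow> partial b f x = f' b"
  unfolding partial_def using frechet_derivative_at by metis

lemma has_derivative_partial:
  assumes "f differentiable (at x)"
  shows "(f has_derivative (\<lambda>h. partial h f x)) (at x)"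
  using assms unfolding partial_def frechet_derivative_works .

lemma partial_add:
  assumes "f differentiable (at x)" "g differentiable (at x)"
  shows "partial b (\<lambda>x. f x + g x) x = partial b f x + partial b g x"
  by (intro partial_eqI has_derivative_add has_derivative_partial assms)

lemma partial_mult:
  assumes "f differentiable (at x)" "g differentiable (at x)"
  shows "partial b (\<lambda>x. f x * g x) x = f x * partial b g x + partial b f x * g x"
  by (intro partial_eqI has_derivative_mult has_derivative_partial assms)

lemma C_k_SucD: "C_k (Suc k) f \<Longrightarrow> C_k k f"
proof (induction k arbitrary: f)
  case 0
  then show ?case
    by (auto simp: continuous_on_eq_continuous_at intro: differentiable_imp_continuous_within)
qed auto

lemma C_k_const: "C_k k (\<lambda>x. a)"
proof (induction k arbitrary: a)
  case (Suc k)
  have "partial b (\<lambda>x. a) = (\<lambda>x. 0)" for b :: 'a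
    using partial_eqI[OF has_derivative_const] by blast
  then show ?case using Suc by auto
qed auto

lemma C_k_add: "C_k k f \<Longrightarrow> C_k k g \<Longrightarrow> C_k k (\<lambda>x. f x + g x)"
proof (induction k arbitrary: f g)
  case 0
  then show ?case by (auto intro: continuous_on_add)
next
  case (Suc k)
  then have "partial b (\<lambda>x. f x + g x) = (\<lambda>x. partial b f x + partial b g x)" for b
    by (auto simp: partial_add)
  then show ?case using Suc by auto
qed

lemma C_k_mult: "C_k k f \<Longrightarrow> C_k k g \<Longrightarrow> C_k k (\<lambda>x. f x * g x)"
proof (induction k arbitrary: f g)
  case 0
  then show ?case by (auto intro: continuous_on_mult)
next
  case (Suc k)
  then have "partial b (\<lambda>x. f x * g x) = (\<lambda>x. f x * partial b g x + partial b f x * g x)" for b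
    by (auto simp: partial_mult)
  then show ?case using Suc C_k_SucD[OF Suc.prems(1)] C_k_SucD[OF Suc.prems(2)]
    by (auto intro!: C_k_add Suc.IH)
qed

abbreviation (input) punctured :: "'a::euclidean_space set" where
  "punctured \<equiv> UNIV - {0}"

abbreviation (input) test_functions_off_0 :: "('a::euclidean_space \<Rightarrow> real) set" where
  "test_functions_off_0 \<equiv> test_functions punctured"

lemma test_differentiable: "f \<in> test_functions S \<Longrightarrow> f differentiable (at x)"
  unfolding test_functions_def using C_k.simps(2) by blast

lemma test_continuous: "f \<in> test_functions S \<Longrightarrow> continuous_on UNIV f"
  unfolding test_functions_def using C_k.simps(1) by blast

text \<open>The condition refers to the closure of the nonvanishing set of \<open>f\<close> so that
  it also covers partial derivatives, which can be nonzero at zeros of \<open>f\<close> but not off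
  that closure.\<close>

lemma test_supportI:
  assumes f: "f \<in> test_functions S" and g: "\<And>k. C_k k g"
    and sub: "\<And>x. g x \<noteq> 0 \<Longrightarrow> x \<in> closure {x. f x \<noteq> 0}"
  shows "g \<in> test_functions S"
proof -
  have *: "closure {x. g x \<noteq> 0} \<subseteq> closure {x. f x \<noteq> 0}"
    using sub by (intro closure_minimal) auto
  then have "compact (closure {x. g x \<noteq> 0})"
    using f closed_Int_compact[of "closure {x. g x \<noteq> 0}" "closure {x. f x \<noteq> 0}"]
    by (simp add: test_functions_def Int_absorb2)
  then show ?thesis using f g * by (auto simp: test_functions_def)
qed

lemma test_zero: "(\<lambda>x. 0) \<in> test_functions S"
  by (simp add: test_functions_def C_k_const)

lemma test_add:
  assumes f: "f \<in> test_functions S" and g: "g \<in> test_functions S"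
  shows "(\<lambda>x. f x + g x) \<in> test_functions S"
proof -
  have "closure {x. f x + g x \<noteq> 0} \<subseteq> closure ({x. f x \<noteq> 0} \<union> {x. g x \<noteq> 0})"
    by (intro closure_mono) auto
  then have *: "closure {x. f x + g x \<noteq> 0} \<subseteq> closure {x. f x \<noteq> 0} \<union> closure {x. g x \<noteq> 0}"
    by (simp add: closure_Un)
  have "compact (closure {x. f x \<noteq> 0} \<union> closure {x. g x \<noteq> 0})"
    using f g by (auto simp: test_functions_def intro: compact_Un)
  then have "compact (closure {x. f x + g x \<noteq> 0})"
    using closed_Int_compact[OF closed_closure] * by (metis Int_absorb2)
  then show ?thesis using f g * by (auto simp: test_functions_def intro: C_k_add)
qed

lemma test_mult:
  assumes "f \<in> test_functions S" "\<And>k. C_k k g"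
  shows "(\<lambda>x. g x * f x) \<in> test_functions S"
proof (rule test_supportI[OF assms(1)])
  show "x \<in> closure {x. f x \<noteq> 0}" if "g x * f x \<noteq> 0" for x
    using that closure_subset[of "{x. f x \<noteq> 0}"] by auto
qed (use assms in \<open>auto intro: C_k_mult simp: test_functions_def\<close>)

lemma test_scale: "f \<in> test_functions S \<Longrightarrow> (\<lambda>x. a * f x) \<in> test_functions S"
  by (intro test_mult C_k_const)

lemma test_diff:
  assumes "f \<in> test_functions S" "g \<in> test_functions S"
  shows "(\<lambda>x. f x - g x) \<in> test_functions S"
  using test_add[OF assms(1) test_scale[OF assms(2), of "-1"]] by simp

lemma test_sum:
  assumes "finite I" "\<And>i. i \<in> I \<Longrightarrow> f i \<in> test_functions S"
  shows "(\<lambda>x. \<Sum>i\<in>I. f i x) \<in> test_functions S"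
  using assms by (induction I rule: finite_induct) (auto intro: test_add test_zero)

lemma partial_eq_0_outside:
  assumes "x \<notin> closure {x. f x \<noteq> 0}"
  shows "(f has_derivative (\<lambda>h. 0)) (at x)" "partial b f x = 0"
proof -
  show "(f has_derivative (\<lambda>h. 0)) (at x)"
    using assms closure_subset[of "{x. f x \<noteq> 0}"]
    by (intro has_derivative_transform_within_open[OF has_derivative_const[of 0], of "- closure {x. f x \<noteq> 0}"])
      auto
  then show "partial b f x = 0" by (rule partial_eqI)
qed

lemma test_partial:
  assumes "f \<in> test_functions S" "b \<in> Basis"
  shows "partial b f \<in> test_functions S"
proof (rule test_supportI[OF assms(1)])
  show "C_k k (partial b f)" for k
    using assms C_k.simps(2)[of k f] unfolding test_functions_def by blast
qed (use partial_eq_0_outside in blast)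

lemma punctured_notin_support:
  "f \<in> test_functions_off_0 \<Longrightarrow> 0 \<notin> closure {x. f x \<noteq> 0}"
  by (auto simp: test_functions_def)

lemma test_at_0: "f \<in> test_functions_off_0 \<Longrightarrow> f 0 = 0"
  using punctured_notin_support closure_subset[of "{x. f x \<noteq> 0}"] by blast

section \<open>Multipliers smooth away from the origin\<close>

text \<open>An algebra of functions that are smooth away from the origin and have arbitrary values there.\<close>

inductive_set smooth_off_0 :: "('a::euclidean_space \<Rightarrow> real) set" where
  const: "(\<lambda>x. a) \<in> smooth_off_0"
| coord: "(\<lambda>x. x \<bullet> b) \<in> smooth_off_0"
| add: "f \<in> smooth_off_0 \<Longrightarrow> g \<in> smooth_off_0 \<Longrightarrow> (\<lambda>x. f x + g x) \<in> smooth_off_0"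
| mult: "f \<in> smooth_off_0 \<Longrightarrow> g \<in> smooth_off_0 \<Longrightarrow> (\<lambda>x. f x * g x) \<in> smooth_off_0"
| power_real: "f \<in> smooth_off_0 \<Longrightarrow> (\<And>x. x \<noteq> 0 \<Longrightarrow> 0 < f x) \<Longrightarrow> (\<lambda>x. f x powr p) \<in> smooth_off_0"
| congr: "f \<in> smooth_off_0 \<Longrightarrow> (\<And>x. x \<noteq> 0 \<Longrightarrow> g x = f x) \<Longrightarrow> g \<in> smooth_off_0"

lemma smooth_off_0_sum:
  assumes "finite I" "\<And>i. i \<in> I \<Longrightarrow> f i \<in> smooth_off_0"
  shows "(\<lambda>x. \<Sum>i\<in>I. f i x) \<in> smooth_off_0"
  using assms by (induction I rule: finite_induct) (auto intro: smooth_off_0.add smooth_off_0.const)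

lemma smooth_off_0_norm: "norm \<in> smooth_off_0"
proof (rule smooth_off_0.congr)
  have "(\<lambda>x::'a. x \<bullet> x) \<in> smooth_off_0"
    by (subst euclidean_inner) (intro smooth_off_0_sum smooth_off_0.mult smooth_off_0.coord finite_Basis)
  then show "(\<lambda>x::'a. (x \<bullet> x) powr (1 / 2)) \<in> smooth_off_0"
    by (rule smooth_off_0.power_real) auto
  show "norm x = (x \<bullet> x) powr (1 / 2)" for x :: 'a
    by (simp add: norm_eq_sqrt_inner powr_half_sqrt)
qed

lemma smooth_off_0_divide:
  assumes "f \<in> smooth_off_0" "g \<in> smooth_off_0" "\<And>x. x \<noteq> 0 \<Longrightarrow> 0 < g x"
  shows "(\<lambda>x. f x / g x) \<in> smooth_off_0"
proof (rule smooth_off_0.congr)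
  show "(\<lambda>x. f x * g x powr (-1)) \<in> smooth_off_0"
    by (intro smooth_off_0.mult smooth_off_0.power_real assms)
  show "f x / g x = f x * g x powr (-1)" if "x \<noteq> 0" for x
    using assms(3)[OF that] by (simp add: powr_minus field_simps)
qed

text \<open>Each directional derivative stays in the same class, so differentiability of every order
  follows by iteration. All the generating operations have derivatives built from these operations;
  positivity of the base keeps \<open>powr\<close> differentiable.\<close>

lemma smooth_off_0_derivative:
  assumes "f \<in> smooth_off_0"
  shows "\<exists>D. (\<forall>h. D h \<in> smooth_off_0) \<and> (\<forall>x. x \<noteq> 0 \<longrightarrow> (f has_derivative (\<lambda>h. D h x)) (at x))"
  using assms
proof induction
  case (const a)
  show ?case by (rule exI[of _ "\<lambda>h x. 0"]) (auto intro: smooth_off_0.const)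
next
  case (coord b)
  show ?case by (rule exI[of _ "\<lambda>h x. h \<bullet> b"])
      (auto intro: smooth_off_0.const has_derivative_inner_left[OF has_derivative_ident])
next
  case (add f g)
  then obtain D E where "\<forall>h. D h \<in> smooth_off_0" "\<forall>h. E h \<in> smooth_off_0"
    "\<forall>x. x \<noteq> 0 \<longrightarrow> (f has_derivative (\<lambda>h. D h x)) (at x)"
    "\<forall>x. x \<noteq> 0 \<longrightarrow> (g has_derivative (\<lambda>h. E h x)) (at x)" by blast
  then show ?case by (intro exI[of _ "\<lambda>h x. D h x + E h x"])
      (auto intro: smooth_off_0.add has_derivative_add)
next
  case (mult f g)
  then obtain D E where "\<forall>h. D h \<in> smooth_off_0" "\<forall>h. E h \<in> smooth_off_0"
    "\<forall>x. x \<noteq> 0 \<longrightarrow> (f has_derivative (\<lambda>h. D h x)) (at x)"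
    "\<forall>x. x \<noteq> 0 \<longrightarrow> (g has_derivative (\<lambda>h. E h x)) (at x)" by blast
  then show ?case using mult.hyps
    by (intro exI[of _ "\<lambda>h x. f x * E h x + D h x * g x"] conjI allI impI
        smooth_off_0.add smooth_off_0.mult has_derivative_mult) simp_all
next
  case (power_real f p)
  then obtain D where D: "\<forall>h. D h \<in> smooth_off_0"
    "\<forall>x. x \<noteq> 0 \<longrightarrow> (f has_derivative (\<lambda>h. D h x)) (at x)" by blast
  have "((\<lambda>x. f x powr p) has_derivative (\<lambda>h. D h x * (p * f x powr (p - 1)))) (at x)" if "x \<noteq> 0" for x
    using that D power_real.hyps by (intro DERIV_compose_FDERIV has_real_derivative_powr) auto
  then show ?case using D power_real.hyps
    by (intro exI[of _ "\<lambda>h x. D h x * (p * f x powr (p - 1))"])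
      (auto intro!: smooth_off_0.mult smooth_off_0.const smooth_off_0.power_real)
next
  case (congr f g)
  then obtain D where "\<forall>h. D h \<in> smooth_off_0"
    "\<forall>x. x \<noteq> 0 \<longrightarrow> (f has_derivative (\<lambda>h. D h x)) (at x)" by blast
  moreover have "(g has_derivative F) (at x)" if "x \<noteq> 0" "(f has_derivative F) (at x)" for x F
    by (rule has_derivative_transform_within_open[OF that(2), of "- {0}"])
      (use that congr.hyps(2) in auto)
  ultimately show ?case by blast
qed

lemma smooth_off_0_differentiable: "f \<in> smooth_off_0 \<Longrightarrow> x \<noteq> 0 \<Longrightarrow> f differentiable (at x)"
  using smooth_off_0_derivative differentiable_def by blast

lemma smooth_off_0_continuous_on: "f \<in> smooth_off_0 \<Longrightarrow> continuous_on punctured f"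
  by (auto intro!: continuous_at_imp_continuous_on differentiable_imp_continuous_within
      smooth_off_0_differentiable)

lemma smooth_off_0_measurable: "f \<in> smooth_off_0 \<Longrightarrow> f \<in> borel_measurable (lebesgue_on punctured)"
  by (intro continuous_imp_measurable_on_sets_lebesgue smooth_off_0_continuous_on) auto

lemma test_smooth_mult_differentiable:
  assumes f: "f \<in> smooth_off_0" and u: "u \<in> test_functions_off_0"
  shows "(\<lambda>x. f x * u x) differentiable (at x)"
proof (cases "x = 0")
  case True
  have "0 \<notin> closure {x. f x * u x \<noteq> 0}"
    using punctured_notin_support[OF u] closure_mono[of "{x. f x * u x \<noteq> 0}" "{x. u x \<noteq> 0}"] by auto
  then show ?thesis using partial_eq_0_outside(1)[of 0 "\<lambda>x. f x * u x"] True
    by (auto simp: differentiable_def)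
next
  case False
  then show ?thesis
    by (intro differentiable_mult smooth_off_0_differentiable[OF f] test_differentiable[OF u])
qed

lemma test_smooth_mult_C_k:
  assumes "f \<in> smooth_off_0" "u \<in> test_functions_off_0"
  shows "C_k k (\<lambda>x. f x * u x)"
  using assms
proof (induction k arbitrary: f u)
  case 0
  then show ?case
    by (auto simp: continuous_on_eq_continuous_at
        intro!: differentiable_imp_continuous_within test_smooth_mult_differentiable)
next
  case (Suc k)
  obtain D where D: "\<And>h. D h \<in> smooth_off_0"
    "\<And>x. x \<noteq> 0 \<Longrightarrow> (f has_derivative (\<lambda>h. D h x)) (at x)"
    using smooth_off_0_derivative[OF Suc.prems(1)] by blast
  have "C_k k (partial b (\<lambda>x. f x * u x))" if b: "b \<in> Basis" for b
  proof -
    have "partial b (\<lambda>x. f x * u x) x = f x * partial b u x + D b x * u x" for x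
    proof (cases "x = 0")
      \<comment> \<open>At the origin \<open>f\<close> may be singular, but \<open>u\<close>
        vanishes on a neighbourhood, so both sides are 0.\<close>
      case True
      have "0 \<notin> closure {x. f x * u x \<noteq> 0}"
        using punctured_notin_support[OF Suc.prems(2)]
          closure_mono[of "{x. f x * u x \<noteq> 0}" "{x. u x \<noteq> 0}"] by auto
      then show ?thesis
        using True partial_eq_0_outside(2)[of 0 u b] punctured_notin_support[OF Suc.prems(2)]
          test_at_0[OF Suc.prems(2)] partial_eq_0_outside(2)[of 0 "\<lambda>x. f x * u x" b] by simp
    next
      case False
      then show ?thesis
        by (intro partial_eqI has_derivative_mult D(2) has_derivative_partial
            test_differentiable[OF Suc.prems(2)])
    qed
    then have "partial b (\<lambda>x. f x * u x) = (\<lambda>x. f x * partial b u x + D b x * u x)" by blast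
    then show ?thesis
      using Suc.IH[OF Suc.prems(1) test_partial[OF Suc.prems(2) b]] Suc.IH[OF D(1) Suc.prems(2)]
      by (simp add: C_k_add)
  qed
  then show ?case using test_smooth_mult_differentiable[OF Suc.prems] by simp
qed

text \<open>This admits the weight, the truncated multiplier and the coefficients of the vector
  field below as factors of test functions, whatever they do at the origin.\<close>

lemma test_smooth_mult:
  assumes "f \<in> smooth_off_0" "u \<in> test_functions_off_0"
  shows "(\<lambda>x. f x * u x) \<in> test_functions_off_0"
proof (rule test_supportI[OF assms(2) test_smooth_mult_C_k[OF assms]])
  show "x \<in> closure {x. u x \<noteq> 0}" if "f x * u x \<noteq> 0" for x
    using that closure_subset[of "{x. u x \<noteq> 0}"] by auto
qed

lemma test_test_mult:
  assumes "f \<in> test_functions S" "g \<in> test_functions S"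
  shows "(\<lambda>x. f x * g x) \<in> test_functions S"
  using assms test_mult[of g S f] by (auto simp: test_functions_def)

section \<open>Integration by parts\<close>

lemma integrable_compact_support:
  fixes f :: "'a::euclidean_space \<Rightarrow> real"
  assumes "continuous_on UNIV f" "compact (closure {x. f x \<noteq> 0})"
  shows "integrable lborel f"
proof -
  have "f = (\<lambda>x. indicator (closure {x. f x \<noteq> 0}) x *\<^sub>R f x)"
    by (rule ext) (use closure_subset[of "{x. f x \<noteq> 0}"] in \<open>auto simp: indicator_def\<close>)
  then show ?thesis
    using borel_integrable_compact[OF assms(2) continuous_on_subset[OF assms(1)]] by simp
qed

lemma test_integrable_lborel: "f \<in> test_functions S \<Longrightarrow> integrable lborel f"
  by (intro integrable_compact_support test_continuous) (auto simp: test_functions_def)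

text \<open>Test functions vanish at the origin, so restricting to the punctured space changes
  nothing; on \<open>lborel\<close> translation invariance becomes available.\<close>

lemma
  fixes f :: "'a::euclidean_space \<Rightarrow> real"
  assumes "f \<in> test_functions_off_0"
  shows test_integrable: "integrable (lebesgue_on punctured) f"
    and test_integral_lborel: "integral\<^sup>L (lebesgue_on punctured) f = integral\<^sup>L lborel f"
proof -
  have i: "(\<lambda>x. indicat_real punctured x * f x) = f"
    using test_at_0[OF assms] by (auto simp: indicator_def)
  have f: "integrable lborel f" by (rule test_integrable_lborel[OF assms])
  show "integrable (lebesgue_on punctured) f"
    using f by (subst integrable_restrict_space) (auto simp: i integrable_completion)
  show "integral\<^sup>L (lebesgue_on punctured) f = integral\<^sup>L lborel f"
    using f by (subst integral_restrict_space) (auto simp: i integral_completion)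
qed

lemma test_L2: "f \<in> test_functions_off_0 \<Longrightarrow> f \<in> L2_space punctured"
  using test_integrable[of f] test_integrable[OF test_test_mult[of f _ f]]
  by (auto simp: L2_space_def power2_eq_square)

lemma integral_lborel_translate:
  fixes f :: "'a::euclidean_space \<Rightarrow> real"
  assumes "integrable lborel f"
  shows "integrable lborel (\<lambda>x. f (a + x))" "(\<integral>x. f (a + x) \<partial>lborel) = integral\<^sup>L lborel f"
proof -
  have *: "f \<in> borel_measurable borel" using assms by simp
  show "integrable lborel (\<lambda>x. f (a + x))"
    using assms integrable_distr_eq[of "(+) a" lborel borel f] * lborel_distr_plus[of a] by simp
  show "(\<integral>x. f (a + x) \<partial>lborel) = integral\<^sup>L lborel f"
    using integral_distr[of "(+) a" lborel borel f] * lborel_distr_plus[of a] by simp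
qed

text \<open>
  The integral of every difference quotient vanishes by translation invariance, and the quotients
  are bounded by the supremum of the derivative on a common compact set.
\<close>

lemma integral_partial_lborel:
  fixes f :: "'a::euclidean_space \<Rightarrow> real"
  assumes f: "f \<in> test_functions S" and b: "b \<in> Basis"
  shows "integral\<^sup>L lborel (partial b f) = 0"
proof -
  define K where "K = closure {x. f x \<noteq> 0}"
  have K: "compact K" using f by (simp add: K_def test_functions_def)
  have pc: "continuous_on UNIV (partial b f)" by (rule test_continuous[OF test_partial[OF f b]])
  obtain M where M: "\<And>x. \<bar>partial b f x\<bar> \<le> M" "0 \<le> M"
  proof -
    have "bounded (partial b f ` K)"
      by (intro compact_imp_bounded compact_continuous_image K continuous_on_subset[OF pc]) auto
    then obtain M where M: "\<And>x. x \<in> K \<Longrightarrow> \<bar>partial b f x\<bar> \<le> M"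
      by (auto simp: bounded_iff)
    \<comment> \<open>If \<open>K\<close> is empty the bound obtained on it may be negative, hence
      the maximum with 0.\<close>
    have "\<bar>partial b f x\<bar> \<le> max M 0" for x
      using M[of x] partial_eq_0_outside(2)[of x f b] by (cases "x \<in> K") (auto simp: K_def)
    then show ?thesis using that by (metis max.cobounded2)
  qed
  obtain R where R: "\<And>x. x \<in> K \<Longrightarrow> norm x \<le> R"
    using compact_imp_bounded[OF K] by (auto simp: bounded_iff)
  define t where "t n = inverse (real (Suc n))" for n
  have t: "t n > 0" "t n \<le> 1" for n by (auto simp: t_def field_simps)
  have t0: "t \<longlonglongrightarrow> 0" unfolding t_def by (rule LIMSEQ_inverse_real_of_nat)
  define Q where "Q n x = (f (t n *\<^sub>R b + x) - f x) / t n" for n x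
  have line: "((\<lambda>s. f (x + s *\<^sub>R b)) has_real_derivative partial b f (x + s *\<^sub>R b)) (at s)" for x s
  proof -
    have "((\<lambda>s. f (x + s *\<^sub>R b)) has_derivative (\<lambda>h. partial (0 + h *\<^sub>R b) f (x + s *\<^sub>R b))) (at s)"
      by (rule has_derivative_compose[of "\<lambda>s. x + s *\<^sub>R b" "\<lambda>h. 0 + h *\<^sub>R b"])
        (auto intro!: has_derivative_partial test_differentiable[OF f] derivative_eq_intros)
    moreover have "partial (h *\<^sub>R b) f (x + s *\<^sub>R b) = partial b f (x + s *\<^sub>R b) * h" for h
      using linear_cmul[OF has_derivative_linear[OF has_derivative_partial[OF test_differentiable[OF f]]]]
      by (simp add: mult.commute)
    ultimately show ?thesis by (simp add: has_field_derivative_def)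
  qed
  have Qlim: "(\<lambda>n. Q n x) \<longlonglongrightarrow> partial b f x" for x
  proof -
    have "((\<lambda>h. (f (x + (0 + h) *\<^sub>R b) - f (x + 0 *\<^sub>R b)) / h) \<longlongrightarrow> partial b f (x + 0 *\<^sub>R b)) (at 0)"
      using line[of x 0] by (simp add: DERIV_def)
    moreover have "filterlim t (at 0) sequentially"
      using t0 t(1) by (intro filterlim_atI always_eventually allI) (metis less_irrefl)+
    ultimately have "(\<lambda>n. (f (x + (0 + t n) *\<^sub>R b) - f (x + 0 *\<^sub>R b)) / t n) \<longlonglongrightarrow> partial b f (x + 0 *\<^sub>R b)"
      by (rule filterlim_compose)
    then show ?thesis by (simp add: Q_def add.commute)
  qed
  \<comment> \<open>On the ball the mean value theorem gives the bound \<open>M\<close>.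
    Translations by at most 1 keep the support inside radius \<open>R + 1\<close>, so the quotient
    vanishes outside.\<close>
  have Qbound: "\<bar>Q n x\<bar> \<le> M * indicator (cball 0 (R + 1)) x" for n x
  proof (cases "x \<in> cball 0 (R + 1)")
    case True
    have "\<exists>z. z > 0 \<and> z < t n \<and> f (x + t n *\<^sub>R b) - f (x + 0 *\<^sub>R b) = (t n - 0) * partial b f (x + z *\<^sub>R b)"
      by (rule MVT2) (use t line in auto)
    then obtain z where "f (x + t n *\<^sub>R b) - f x = t n * partial b f (x + z *\<^sub>R b)" by auto
    then have "Q n x = partial b f (x + z *\<^sub>R b)"
      using t[of n] by (simp add: Q_def add.commute)
    then show ?thesis using True M by simp
  next
    case False
    then have n: "norm x > R + 1" by simp
    have "norm x \<le> norm (t n *\<^sub>R b + x) + norm (t n *\<^sub>R b)"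
      by (metis add.commute add_diff_cancel_left' norm_triangle_sub norm_minus_commute norm_triangle_ineq4)
    then have "norm (t n *\<^sub>R b + x) > R" using n t[of n] b by simp
    then have "t n *\<^sub>R b + x \<notin> K" "x \<notin> K" using R n by force+
    then have "f (t n *\<^sub>R b + x) = 0" "f x = 0"
      using closure_subset[of "{x. f x \<noteq> 0}"] unfolding K_def by blast+
    then have "Q n x = 0" by (simp add: Q_def[abs_def])
    then show ?thesis using M by simp
  qed
  have fi: "integrable lborel f" by (rule test_integrable_lborel[OF f])
  have Q0: "integral\<^sup>L lborel (Q n) = 0" for n
    using integral_lborel_translate[OF fi, of "t n *\<^sub>R b"] fi by (simp add: Q_def[abs_def])
  have "(\<lambda>n. integral\<^sup>L lborel (Q n)) \<longlonglongrightarrow> integral\<^sup>L lborel (partial b f)"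
  proof (rule integral_dominated_convergence[where w = "\<lambda>x. M * indicator (cball 0 (R + 1)) x"])
    show "partial b f \<in> borel_measurable lborel"
      using borel_measurable_continuous_onI[OF pc] by simp
    show "Q n \<in> borel_measurable lborel" for n
      using borel_measurable_integrable[OF integral_lborel_translate(1)[OF fi, of "t n *\<^sub>R b"]]
        borel_measurable_integrable[OF fi] by (simp add: Q_def[abs_def])
    show "integrable lborel (\<lambda>x. M * indicator (cball (0::'a) (R + 1)) x)"
      using borel_integrable_compact[of "cball (0::'a) (R + 1)" "\<lambda>x. 1::real"] by simp
  qed (use Qlim Qbound in auto)
  then show ?thesis by (simp add: Q0 LIMSEQ_const_iff)
qed

lemma integral_partial:
  "f \<in> test_functions_off_0 \<Longrightarrow> b \<in> Basis \<Longrightarrow> integral\<^sup>L (lebesgue_on punctured) (partial b f) = 0"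
  by (simp add: integral_partial_lborel test_integral_lborel test_partial)

section \<open>Closability of the weighted form\<close>

locale smooth_weight =
  fixes c :: "'a::euclidean_space \<Rightarrow> real"
  assumes c_smooth: "c \<in> smooth_off_0"
    and c_pos: "\<And>x. x \<noteq> 0 \<Longrightarrow> 0 < c x"
begin

definition core_bilinear :: "('a \<Rightarrow> real) \<Rightarrow> ('a \<Rightarrow> real) \<Rightarrow> real" where
  "core_bilinear f g = (\<Sum>b\<in>Basis. L2_inner punctured (partial b f) (\<lambda>x. c x * partial b g x))"

lemma core_form_eq: "core_form punctured c f = core_bilinear f f"
  by (simp add: core_form_def core_bilinear_def)

lemma core_bilinear_integrand_test:
  assumes "f \<in> test_functions_off_0" "g \<in> test_functions_off_0" "b \<in> Basis"
  shows "(\<lambda>x. c x * (partial b f x * partial b g x)) \<in> test_functions_off_0"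
  by (intro test_smooth_mult[OF c_smooth] test_test_mult test_partial assms)

lemma core_bilinear_integral:
  assumes "f \<in> test_functions_off_0" "g \<in> test_functions_off_0"
  shows "core_bilinear f g =
    (\<integral>x. c x * (\<Sum>b\<in>Basis. partial b f x * partial b g x) \<partial>(lebesgue_on punctured))"
  using test_integrable[OF core_bilinear_integrand_test[OF assms]]
  by (simp add: core_bilinear_def L2_inner_def sum_distrib_left mult_ac Bochner_Integration.integral_sum)

sublocale form: semi_inner test_functions_off_0 core_bilinear
proof
  fix f g h :: "'a \<Rightarrow> real" and a :: real
  show "core_bilinear f g = core_bilinear g f"
    by (simp add: core_bilinear_def L2_inner_def mult_ac)
  assume f: "f \<in> test_functions_off_0"
  have "0 \<le> c x * (\<Sum>b\<in>Basis. partial b f x * partial b f x)" if "x \<noteq> 0" for x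
    using c_pos[OF that] sum_nonneg[of Basis "\<lambda>b. partial b f x * partial b f x"] by simp
  then show "0 \<le> core_bilinear f f"
    unfolding core_bilinear_integral[OF f f] by (intro integral_nonneg_AE) auto
  assume g: "g \<in> test_functions_off_0"
  show fg: "(\<lambda>x. f x + a * g x) \<in> test_functions_off_0"
    by (intro test_add test_scale f g)
  assume h: "h \<in> test_functions_off_0"
  have "partial b (\<lambda>x. f x + a * g x) x = partial b f x + a * partial b g x" for b x
    by (intro partial_eqI has_derivative_add has_derivative_mult_right has_derivative_partial
        test_differentiable[OF f] test_differentiable[OF g])
  then have "core_bilinear (\<lambda>x. f x + a * g x) h =
      (\<integral>x. c x * (\<Sum>b\<in>Basis. partial b f x * partial b h x)
        + a * (c x * (\<Sum>b\<in>Basis. partial b g x * partial b h x)) \<partial>(lebesgue_on punctured))"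
    unfolding core_bilinear_integral[OF fg h]
    by (simp add: algebra_simps sum.distrib sum_distrib_left)
  also have "\<dots> = core_bilinear f h + a * core_bilinear g h"
    unfolding core_bilinear_integral[OF f h] core_bilinear_integral[OF g h]
    using test_integrable[OF core_bilinear_integrand_test[OF f h]]
      test_integrable[OF core_bilinear_integrand_test[OF g h]]
    by (simp add: sum_distrib_left)
  finally show "core_bilinear (\<lambda>x. f x + a * g x) h = core_bilinear f h + a * core_bilinear g h" .
qed

text \<open>The representing function is -div(c grad f). It is itself a test function, hence in L2;
  there is no boundary term at the origin because test functions vanish near it.\<close>

lemma core_bilinear_by_parts:
  assumes f: "f \<in> test_functions_off_0"
  shows "\<exists>\<eta> \<in> L2_space punctured. \<forall>g \<in> test_functions_off_0. core_bilinear f g = L2_inner punctured \<eta> g"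
proof -
  define F where "F b x = c x * partial b f x" for b x
  have F: "F b \<in> test_functions_off_0" if "b \<in> Basis" for b
    unfolding F_def by (intro test_smooth_mult[OF c_smooth] test_partial[OF f that])
  define \<eta> where "\<eta> x = (\<Sum>b\<in>Basis. (-1) * partial b (F b) x)" for x
  have \<eta>: "\<eta> \<in> test_functions_off_0"
    unfolding \<eta>_def by (intro test_sum test_scale test_partial F) auto
  have "core_bilinear f g = L2_inner punctured \<eta> g" if g: "g \<in> test_functions_off_0" for g
  proof -
    have 1: "(\<integral>x. F b x * partial b g x \<partial>(lebesgue_on punctured))
        = (\<integral>x. (-1) * (partial b (F b) x * g x) \<partial>(lebesgue_on punctured))" if b: "b \<in> Basis" for b
    proof -
      have i: "integrable (lebesgue_on punctured) (\<lambda>x. F b x * partial b g x)"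
        "integrable (lebesgue_on punctured) (\<lambda>x. partial b (F b) x * g x)"
        by (intro test_integrable test_test_mult test_partial F g b)+
      have "0 = (\<integral>x. partial b (\<lambda>x. F b x * g x) x \<partial>(lebesgue_on punctured))"
        using integral_partial[OF test_test_mult[OF F[OF b] g] b] by simp
      also have "\<dots> = (\<integral>x. F b x * partial b g x + partial b (F b) x * g x \<partial>(lebesgue_on punctured))"
        by (simp add: partial_mult[OF test_differentiable[OF F[OF b]] test_differentiable[OF g]])
      finally show ?thesis using i by simp
    qed
    have "core_bilinear f g = (\<Sum>b\<in>Basis. \<integral>x. F b x * partial b g x \<partial>(lebesgue_on punctured))"
      by (simp add: core_bilinear_def L2_inner_def F_def mult_ac)
    also have "\<dots> = (\<Sum>b\<in>Basis. \<integral>x. (-1) * (partial b (F b) x * g x) \<partial>(lebesgue_on punctured))"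
      by (rule sum.cong[OF refl 1])
    also have "\<dots> = (\<integral>x. (\<Sum>b\<in>Basis. (-1) * (partial b (F b) x * g x)) \<partial>(lebesgue_on punctured))"
      by (rule Bochner_Integration.integral_sum[symmetric], intro test_integrable test_scale test_test_mult test_partial F g)
    also have "\<dots> = L2_inner punctured \<eta> g"
      by (simp add: L2_inner_def \<eta>_def sum_distrib_left mult_ac sum_negf)
    finally show ?thesis .
  qed
  then show ?thesis using test_L2[OF \<eta>] by blast
qed

text \<open>Split h(\<Phi>_n) = h(\<Phi>_n, \<Phi>_n - \<Phi>_m) + h(\<Phi>_n, \<Phi>_m). For fixed
  n the last term tends to 0 as m grows, by integration by parts and L2 convergence; the first is at
  most the square root of h(\<Phi>_n) e. Letting m tend to infinity and cancelling a root leaves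
  h(\<Phi>_n) <= e.\<close>

lemma closable:
  assumes T: "\<And>n. \<Phi> n \<in> test_functions_off_0"
    and L2: "(\<lambda>n. L2_norm punctured (\<Phi> n)) \<longlonglongrightarrow> 0"
    and cauchy: "\<And>e. e > 0 \<Longrightarrow> \<exists>N. \<forall>m\<ge>N. \<forall>n\<ge>N.
      core_bilinear (\<lambda>x. \<Phi> m x - \<Phi> n x) (\<lambda>x. \<Phi> m x - \<Phi> n x) < e"
  shows "(\<lambda>n. core_bilinear (\<Phi> n) (\<Phi> n)) \<longlonglongrightarrow> 0"
proof (rule LIMSEQ_I)
  fix r :: real assume r: "0 < r"
  \<comment> \<open>The argument yields only a non-strict bound by \<open>e\<close>; halving makes
    it strict against \<open>r\<close>.\<close>
  define e where "e = r / 2"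
  have e: "0 < e" "e < r" using r by (auto simp: e_def)
  obtain N where N: "\<And>m n. m \<ge> N \<Longrightarrow> n \<ge> N \<Longrightarrow>
      core_bilinear (\<lambda>x. \<Phi> m x - \<Phi> n x) (\<lambda>x. \<Phi> m x - \<Phi> n x) < e"
    using cauchy[OF e(1)] by blast
  have "core_bilinear (\<Phi> n) (\<Phi> n) \<le> e" if n: "n \<ge> N" for n
  proof -
    obtain \<eta> where \<eta>: "\<eta> \<in> L2_space punctured"
      "\<And>g. g \<in> test_functions_off_0 \<Longrightarrow> core_bilinear (\<Phi> n) g = L2_inner punctured \<eta> g"
      using core_bilinear_by_parts[OF T] by blast
    have L: "(\<lambda>m. sqrt (L2_inner punctured \<eta> \<eta>) * L2_norm punctured (\<Phi> m)) \<longlonglongrightarrow> 0"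
      using tendsto_mult_right_zero[OF L2] .
    have "(\<lambda>m. core_bilinear (\<Phi> n) (\<Phi> m)) \<longlonglongrightarrow> 0"
      using L2.Cauchy_Schwarz[OF \<eta>(1) test_L2[OF T]]
      by (intro Lim_null_comparison[OF always_eventually L]) (simp add: \<eta>(2)[OF T] L2_norm_def)
    then have lim: "(\<lambda>m. core_bilinear (\<Phi> n) (\<Phi> m) + sqrt (core_bilinear (\<Phi> n) (\<Phi> n)) * sqrt e)
        \<longlonglongrightarrow> 0 + sqrt (core_bilinear (\<Phi> n) (\<Phi> n)) * sqrt e"
      by (intro tendsto_add tendsto_const)
    have "core_bilinear (\<Phi> n) (\<Phi> n)
        \<le> core_bilinear (\<Phi> n) (\<Phi> m) + sqrt (core_bilinear (\<Phi> n) (\<Phi> n)) * sqrt e" if "m \<ge> N" for m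
    proof -
      have "core_bilinear (\<Phi> n) (\<Phi> n) - core_bilinear (\<Phi> n) (\<Phi> m)
          \<le> sqrt (core_bilinear (\<Phi> n) (\<Phi> n))
            * sqrt (core_bilinear (\<lambda>x. \<Phi> n x - \<Phi> m x) (\<lambda>x. \<Phi> n x - \<Phi> m x))"
        using form.Cauchy_Schwarz[OF T[of n] form.diff_closed[OF T[of n] T[of m]]]
          form.B_diff_right[OF T[of n] T[of m] T[of n]] by simp
      also have "\<dots> \<le> sqrt (core_bilinear (\<Phi> n) (\<Phi> n)) * sqrt e"
        using N[OF n that] form.B_nonneg[OF T[of n]] by (intro mult_left_mono) auto
      finally show ?thesis by simp
    qed
    then have le: "core_bilinear (\<Phi> n) (\<Phi> n) \<le> sqrt (core_bilinear (\<Phi> n) (\<Phi> n)) * sqrt e"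
      using LIMSEQ_le_const[OF lim] by auto
    have s: "s \<le> sqrt e" if "s * s \<le> s * sqrt e" "0 \<le> s" for s
      using that e(1) by (cases "s = 0") auto
    have "sqrt (core_bilinear (\<Phi> n) (\<Phi> n)) \<le> sqrt e"
      by (rule s) (use le form.B_nonneg[OF T[of n]] in simp_all)
    then show ?thesis by simp
  qed
  then show "\<exists>no. \<forall>n\<ge>no. norm (core_bilinear (\<Phi> n) (\<Phi> n) - 0) < r"
    using form.B_nonneg[OF T] e(2) by (intro exI[of _ N]) (auto intro: le_less_trans)
qed

section \<open>The closed form as a limit along approximating sequences\<close>

lemma form_approx_lin:
  assumes \<Phi>: "form_approx punctured c \<Phi> \<phi>" and \<Psi>: "form_approx punctured c \<Psi> \<psi>"
    and \<phi>: "\<phi> \<in> L2_space punctured" and \<psi>: "\<psi> \<in> L2_space punctured"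
  shows "form_approx punctured c (\<lambda>n x. \<Phi> n x + a * \<Psi> n x) (\<lambda>x. \<phi> x + a * \<psi> x)"
proof -
  have T: "\<Phi> n \<in> test_functions_off_0" "\<Psi> n \<in> test_functions_off_0" for n using \<Phi> \<Psi> by (auto simp: form_approx_def)
  have L: "(\<lambda>n. L2_norm punctured (\<lambda>x. \<Phi> n x - \<phi> x)
      + \<bar>a\<bar> * L2_norm punctured (\<lambda>x. \<Psi> n x - \<psi> x)) \<longlonglongrightarrow> 0 + \<bar>a\<bar> * 0"
    using \<Phi> \<Psi> unfolding form_approx_def by (intro tendsto_add tendsto_mult tendsto_const) auto
  have "L2_norm punctured (\<lambda>x. \<Phi> n x + a * \<Psi> n x - (\<phi> x + a * \<psi> x))
      \<le> L2_norm punctured (\<lambda>x. \<Phi> n x - \<phi> x) + \<bar>a\<bar> * L2_norm punctured (\<lambda>x. \<Psi> n x - \<psi> x)" for n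
    using L2.triangle[OF L2.diff_closed[OF test_L2[OF T(1)[of n]] \<phi>] L2.diff_closed[OF test_L2[OF T(2)[of n]] \<psi>], of a]
    by (simp add: L2_norm_def algebra_simps)
  moreover have "0 \<le> L2_norm punctured (\<lambda>x. \<Phi> n x + a * \<Psi> n x - (\<phi> x + a * \<psi> x))" for n
    unfolding L2_norm_def
    by (intro real_sqrt_ge_zero L2.B_nonneg L2.diff_closed L2.lin test_L2[OF T(1)] test_L2[OF T(2)] \<phi> \<psi>)
  ultimately have 1: "(\<lambda>n. L2_norm punctured (\<lambda>x. \<Phi> n x + a * \<Psi> n x - (\<phi> x + a * \<psi> x))) \<longlonglongrightarrow> 0"
    using L by (intro Lim_null_comparison[OF always_eventually L[simplified]]) simp
  have 2: "\<exists>N. \<forall>m\<ge>N. \<forall>n\<ge>N. core_form punctured c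
      (\<lambda>x. \<Phi> m x + a * \<Psi> m x - (\<Phi> n x + a * \<Psi> n x)) < e" if e: "e > 0" for e
  proof -
    \<comment> \<open>The triangle inequality costs a factor \<open>1 + \<bar>a\<bar>\<close> on
      square roots; dividing by \<open>2 + \<bar>a\<bar>\<close> leaves room for strictness.\<close>
    define r where "r = (sqrt e / (2 + \<bar>a\<bar>))\<^sup>2"
    have r0: "sqrt r = sqrt e / (2 + \<bar>a\<bar>)" "r > 0"
      unfolding r_def real_sqrt_abs using e by auto
    have r: "r > 0" "sqrt r * (1 + \<bar>a\<bar>) < sqrt e"
      using e r0(2) unfolding r0(1) by (simp_all add: field_simps)
    obtain N M where N: "\<And>m n. m \<ge> N \<Longrightarrow> n \<ge> N \<Longrightarrow> core_form punctured c (\<lambda>x. \<Phi> m x - \<Phi> n x) < r"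
      and M: "\<And>m n. m \<ge> M \<Longrightarrow> n \<ge> M \<Longrightarrow> core_form punctured c (\<lambda>x. \<Psi> m x - \<Psi> n x) < r"
      using \<Phi> \<Psi> r(1) unfolding form_approx_def by meson
    have "core_form punctured c (\<lambda>x. \<Phi> m x + a * \<Psi> m x - (\<Phi> n x + a * \<Psi> n x)) < e"
      if "m \<ge> max N M" "n \<ge> max N M" for m n
    proof -
      have "sqrt (core_form punctured c (\<lambda>x. \<Phi> m x + a * \<Psi> m x - (\<Phi> n x + a * \<Psi> n x)))
          \<le> sqrt (core_form punctured c (\<lambda>x. \<Phi> m x - \<Phi> n x))
            + \<bar>a\<bar> * sqrt (core_form punctured c (\<lambda>x. \<Psi> m x - \<Psi> n x))"
        using form.triangle[OF form.diff_closed[OF T(1)[of m] T(1)[of n]]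
            form.diff_closed[OF T(2)[of m] T(2)[of n]], of a]
        by (simp add: core_form_eq algebra_simps)
      also have "\<dots> \<le> sqrt r + \<bar>a\<bar> * sqrt r"
        using N[of m n] M[of m n] that by (intro add_mono mult_left_mono) auto
      also have "\<dots> < sqrt e" using r(2) by (simp add: algebra_simps)
      finally show ?thesis by simp
    qed
    then show ?thesis by blast
  qed
  show ?thesis unfolding form_approx_def using form.lin[OF T] 1 2 by auto
qed

text \<open>Justifies the definite description in \<open>closed_form\<close>: two sequences for the
  same function differ by one that approximates 0, and closability makes the form of this difference
  vanish in the limit.\<close>

lemma closed_form_lim:
  assumes \<Phi>: "form_approx punctured c \<Phi> \<phi>" and \<phi>: "\<phi> \<in> L2_space punctured"
  shows "(\<lambda>n. core_bilinear (\<Phi> n) (\<Phi> n)) \<longlonglongrightarrow> closed_form punctured c \<phi>"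
proof -
  have T: "\<Phi> n \<in> test_functions_off_0" for n using \<Phi> by (auto simp: form_approx_def)
  obtain l where l: "(\<lambda>n. core_bilinear (\<Phi> n) (\<Phi> n)) \<longlonglongrightarrow> l"
    using form.Cauchy_convergent[of \<Phi>] \<Phi> by (auto simp: form_approx_def core_form_eq)
  have "l' = l" if \<Psi>: "form_approx punctured c \<Psi> \<phi>"
    and l': "(\<lambda>n. core_bilinear (\<Psi> n) (\<Psi> n)) \<longlonglongrightarrow> l'" for \<Psi> l'
  proof -
    have T': "\<Psi> n \<in> test_functions_off_0" for n using \<Psi> by (auto simp: form_approx_def)
    have A: "form_approx punctured c (\<lambda>n x. \<Psi> n x - \<Phi> n x) (\<lambda>x. 0)"
      using form_approx_lin[OF \<Psi> \<Phi> \<phi> \<phi>, of "-1"] by simp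
    have "(\<lambda>n. core_bilinear (\<lambda>x. \<Psi> n x - \<Phi> n x) (\<lambda>x. \<Psi> n x - \<Phi> n x)) \<longlonglongrightarrow> 0"
      using A by (intro closable form.diff_closed T T') (auto simp: form_approx_def core_form_eq)
    from tendsto_real_sqrt[OF this]
    have "(\<lambda>n. core_bilinear (\<Psi> n) (\<Psi> n)) \<longlonglongrightarrow> l"
      by (intro form.tendsto_norm[OF T' T _ l]) simp
    then show ?thesis using l' LIMSEQ_unique by blast
  qed
  then have "closed_form punctured c \<phi> = l"
    unfolding closed_form_def core_form_eq by - (rule the_equality, use \<Phi> l in blast, blast)
  then show ?thesis using l by simp
qed

lemma closed_bilinear_lim:
  assumes \<Phi>: "form_approx punctured c \<Phi> \<phi>" and \<Psi>: "form_approx punctured c \<Psi> \<psi>"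
    and \<phi>: "\<phi> \<in> L2_space punctured" and \<psi>: "\<psi> \<in> L2_space punctured"
  shows "(\<lambda>n. core_bilinear (\<Phi> n) (\<Psi> n)) \<longlonglongrightarrow> closed_bilinear punctured c \<phi> \<psi>"
proof -
  have T: "\<Phi> n \<in> test_functions_off_0" "\<Psi> n \<in> test_functions_off_0" for n using \<Phi> \<Psi> by (auto simp: form_approx_def)
  \<comment> \<open>Polarisation: expanding both quadratics leaves 4 h(\<Phi>_n, \<Psi>_n). The
    coefficients 1 and -1 are written out to match \<open>form_approx_lin\<close>.\<close>
  have "(\<lambda>n. (core_bilinear (\<lambda>x. \<Phi> n x + 1 * \<Psi> n x) (\<lambda>x. \<Phi> n x + 1 * \<Psi> n x)
      - core_bilinear (\<lambda>x. \<Phi> n x + (-1) * \<Psi> n x) (\<lambda>x. \<Phi> n x + (-1) * \<Psi> n x)) / 4)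
    \<longlonglongrightarrow> (closed_form punctured c (\<lambda>x. \<phi> x + 1 * \<psi> x)
      - closed_form punctured c (\<lambda>x. \<phi> x + (-1) * \<psi> x)) / 4"
    by (intro tendsto_divide tendsto_diff tendsto_const closed_form_lim form_approx_lin \<Phi> \<Psi>
        L2.lin \<phi> \<psi>) auto
  then show ?thesis
    unfolding form.B_quadratic[OF T] by (simp add: closed_bilinear_def)
qed

end

section \<open>The Rellich inequality\<close>

text \<open>For a radial function \<open>f\<close> of \<open>r = \<bar>x\<bar>\<close> the number \<open>k\<close> below is \<open>r f'(r)\<close>.\<close>

definition has_radial_derivative :: "('a::euclidean_space \<Rightarrow> real) \<Rightarrow> real \<Rightarrow> 'a \<Rightarrow> bool" where
  "has_radial_derivative f k x \<longleftrightarrow> (f has_derivative (\<lambda>h. k * (x \<bullet> h) / (norm x)\<^sup>2)) (at x)"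

lemma radial_derivative_norm: "x \<noteq> 0 \<Longrightarrow> has_radial_derivative norm (norm x) x"
  unfolding has_radial_derivative_def
  by (rule has_derivative_eq_rhs[OF has_derivative_norm]) (auto simp: sgn_div_norm power2_eq_square inner_commute divide_inverse)

lemma radial_derivative_compose:
  assumes "has_radial_derivative f k x" "DERIV F (f x) :> D"
  shows "has_radial_derivative (\<lambda>x. F (f x)) (D * k) x"
  using DERIV_compose_FDERIV[OF assms(2) assms(1)[unfolded has_radial_derivative_def]]
  by (simp add: has_radial_derivative_def mult_ac)

lemma radial_derivative_mult:
  assumes "has_radial_derivative f k x" "has_radial_derivative g l x"
  shows "has_radial_derivative (\<lambda>x. f x * g x) (k * g x + f x * l) x"
  using has_derivative_mult[OF assms[unfolded has_radial_derivative_def]]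
  by (simp add: has_radial_derivative_def add_divide_distrib algebra_simps)

lemma radial_derivative_add:
  assumes "has_radial_derivative f k x" "has_radial_derivative g l x"
  shows "has_radial_derivative (\<lambda>x. f x + g x) (k + l) x"
  using has_derivative_add[OF assms[unfolded has_radial_derivative_def]]
  by (simp add: has_radial_derivative_def add_divide_distrib algebra_simps)

lemma radial_derivative_inverse:
  assumes "has_radial_derivative f k x" "f x \<noteq> 0"
  shows "has_radial_derivative (\<lambda>x. inverse (f x)) (- k / (f x)\<^sup>2) x"
  using radial_derivative_compose[OF assms(1) DERIV_inverse[OF assms(2)]]
  by (simp add: divide_inverse power2_eq_square mult_ac)

lemma radial_derivative_congr:
  assumes "has_radial_derivative f k x" "x \<noteq> 0" "\<And>y. y \<noteq> 0 \<Longrightarrow> f y = g y"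
  shows "has_radial_derivative g k x"
  unfolding has_radial_derivative_def
  by (rule has_derivative_transform_within_open[OF assms(1)[unfolded has_radial_derivative_def], of "- {0}"])
    (use assms in auto)

text \<open>
  With \<open>t = r / (1 + r)\<close>, \<open>e = r c' / c\<close> and \<open>\<sigma> = (e + d - 2) / 2\<close> the last term is \<open>r \<sigma>'\<close>.
\<close>

lemma hardy_constant_bound:
  fixes \<delta> \<delta>' d t e :: real
  assumes d: "1 \<le> d" and t: "0 \<le> t" "t \<le> 1" and s: "4 \<le> \<delta> + \<delta>'"
    and e: "e = \<delta> + (\<delta>' - \<delta>) * t"
  shows "(d - \<bar>\<delta> - \<delta>'\<bar>) * (d + \<delta> + \<delta>' - 4) / 4
    \<le> ((e + d - 2) / 2)\<^sup>2 - ((e - 2) / 2)\<^sup>2 + (\<delta>' - \<delta>) * (t * (1 - t)) / 2"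
proof (cases "\<delta> \<le> \<delta>'")
  case True
  \<comment> \<open>The gap between the two sides is exactly this sum of nonnegative terms; the
    first of them uses \<delta> + \<delta>' >= 4.\<close>
  have "0 \<le> (\<delta>' - \<delta>) * (\<delta> + \<delta>' - 4) / 4 + d * ((\<delta>' - \<delta>) * t) / 2 + (\<delta>' - \<delta>) * (t * (1 - t)) / 2"
    using True d t s by (intro add_nonneg_nonneg divide_nonneg_nonneg mult_nonneg_nonneg) auto
  also have "\<dots> = ((e + d - 2) / 2)\<^sup>2 - ((e - 2) / 2)\<^sup>2 + (\<delta>' - \<delta>) * (t * (1 - t)) / 2
      - (d - \<bar>\<delta> - \<delta>'\<bar>) * (d + \<delta> + \<delta>' - 4) / 4"
    using True unfolding e by (simp add: power2_eq_square field_simps)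
  finally show ?thesis by simp
next
  case False
  \<comment> \<open>Now r \<sigma>' is nonpositive. It is absorbed by the gain d (\<delta> -
    \<delta>') (1 - t)/2 of e over its limit \<delta>', which leaves the factor (1 - t)(d - t),
    nonnegative since t <= 1 <= d.\<close>
  have "0 \<le> (\<delta> - \<delta>') * (\<delta> + \<delta>' - 4) / 4 + (\<delta> - \<delta>') * ((1 - t) * (d - t)) / 2"
    using False d t s by (intro add_nonneg_nonneg divide_nonneg_nonneg mult_nonneg_nonneg) auto
  also have "\<dots> = ((e + d - 2) / 2)\<^sup>2 - ((e - 2) / 2)\<^sup>2 + (\<delta>' - \<delta>) * (t * (1 - t)) / 2
      - (d - \<bar>\<delta> - \<delta>'\<bar>) * (d + \<delta> + \<delta>' - 4) / 4"
    using False unfolding e by (simp add: power2_eq_square field_simps)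
  finally show ?thesis by simp
qed

section \<open>The weight, its logarithmic slope and the truncated multiplier\<close>

locale radial_weight =
  fixes \<delta> \<delta>' :: real and c :: "'a::euclidean_space \<Rightarrow> real"
  assumes c_eq: "\<And>x. x \<noteq> 0 \<Longrightarrow> c x = norm x powr \<delta> * (1 + norm x) powr (\<delta>' - \<delta>)"
    and \<delta>_nonneg: "0 \<le> \<delta>" "0 \<le> \<delta>'"
begin

sublocale smooth_weight c
proof
  have pos: "0 < 1 + norm x" for x :: 'a
    by (rule add_pos_nonneg) auto
  have "(\<lambda>x::'a. norm x powr \<delta> * (1 + norm x) powr (\<delta>' - \<delta>)) \<in> smooth_off_0"
    by (intro smooth_off_0.intros(1,3-5) smooth_off_0_norm) (simp_all add: pos)
  then show "c \<in> smooth_off_0" by (rule smooth_off_0.congr) (rule c_eq)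
  show "0 < c x" if "x \<noteq> 0" for x using that pos[of x] by (simp add: c_eq)
qed

text \<open>This is e = r c'(r)/c(r). It interpolates between \<delta> at the origin and \<delta>'
  at infinity with parameter t = r/(1 + r), hence is bounded.\<close>

definition log_slope :: "'a \<Rightarrow> real" where
  "log_slope x = \<delta> + (\<delta>' - \<delta>) * (norm x / (1 + norm x))"

lemma log_slope_bound: "\<bar>log_slope x - 2\<bar> \<le> \<delta> + \<delta>' + 2"
proof -
  define t where "t = norm x / (1 + norm x)"
  have "0 < 1 + norm x" by (rule add_pos_nonneg) auto
  then have t: "0 \<le> t" "t \<le> 1" by (auto simp: t_def)
  have "log_slope x = \<delta> * (1 - t) + \<delta>' * t" by (simp add: log_slope_def t_def[symmetric] algebra_simps)
  moreover have "0 \<le> \<delta> * (1 - t)" "0 \<le> \<delta>' * t" "\<delta> * (1 - t) \<le> \<delta>" "\<delta>' * t \<le> \<delta>'"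
    using t \<delta>_nonneg by (auto simp: mult_left_le)
  ultimately show ?thesis by linarith
qed

lemma c_radial_derivative:
  assumes x: "x \<noteq> 0"
  shows "has_radial_derivative c (c x * log_slope x) x"
proof -
  define r where "r = norm x"
  have r: "0 < r" "0 < 1 + r" using x by (auto simp: r_def add_pos_pos)
  have "DERIV (\<lambda>r. r powr \<delta> * (1 + r) powr (\<delta>' - \<delta>)) r :>
      \<delta> * r powr (\<delta> - 1) * (1 + r) powr (\<delta>' - \<delta>)
      + (\<delta>' - \<delta>) * (1 + r) powr (\<delta>' - \<delta> - 1) * r powr \<delta>"
  proof -
    have "DERIV (\<lambda>r. (1 + r) powr p) r :> p * (1 + r) powr (p - 1)" for p
    proof -
      have "DERIV (\<lambda>r. 1 + r) r :> 1" by (auto intro!: derivative_eq_intros)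
      from DERIV_chain2[where f = "\<lambda>z. z powr p", OF has_real_derivative_powr[OF r(2)] this]
      show ?thesis by simp
    qed
    then show ?thesis by (intro DERIV_mult has_real_derivative_powr r)
  qed
  then have "has_radial_derivative (\<lambda>x. norm x powr \<delta> * (1 + norm x) powr (\<delta>' - \<delta>))
      ((\<delta> * r powr (\<delta> - 1) * (1 + r) powr (\<delta>' - \<delta>)
      + (\<delta>' - \<delta>) * (1 + r) powr (\<delta>' - \<delta> - 1) * r powr \<delta>) * norm x) x"
    unfolding r_def by (intro radial_derivative_compose[OF radial_derivative_norm[OF x]])
  moreover have "(\<delta> * r powr (\<delta> - 1) * (1 + r) powr (\<delta>' - \<delta>)
      + (\<delta>' - \<delta>) * (1 + r) powr (\<delta>' - \<delta> - 1) * r powr \<delta>) * norm x = c x * log_slope x"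
  proof -
    have "(\<delta> * (P / r) * Q + \<beta> * (Q / s) * P) * r = P * Q * (\<delta> + \<beta> * (r / s))"
      if "0 < s" for P Q \<beta> s
      using that r by (simp add: field_simps)
    moreover have "r powr (\<delta> - 1) = r powr \<delta> / r"
      "(1 + r) powr (\<delta>' - \<delta> - 1) = (1 + r) powr (\<delta>' - \<delta>) / (1 + r)"
      using r powr_diff[of r \<delta> 1] powr_diff[of "1 + r" "\<delta>' - \<delta>" 1] by auto
    ultimately show ?thesis unfolding c_eq[OF x] log_slope_def r_def[symmetric] using r(2) by metis
  qed
  ultimately show ?thesis
    by (intro radial_derivative_congr[OF _ x c_eq[symmetric]]) simp_all
qed

text \<open>This is w^2/(1 + \<epsilon> w^2) with w^2 = c/r^2, after clearing r^2.\<close>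

definition trunc :: "real \<Rightarrow> 'a \<Rightarrow> real" where
  "trunc \<epsilon> x = c x / ((norm x)\<^sup>2 + \<epsilon> * c x)"

definition trunc_slope :: "real \<Rightarrow> 'a \<Rightarrow> real" where
  "trunc_slope \<epsilon> x = (log_slope x - 2) * ((norm x)\<^sup>2 / ((norm x)\<^sup>2 + \<epsilon> * c x))"

context
  fixes \<epsilon> :: real assumes \<epsilon>: "0 < \<epsilon>"
begin

lemma denominator_pos: "x \<noteq> 0 \<Longrightarrow> 0 < (norm x)\<^sup>2 + \<epsilon> * c x"
  using c_pos[of x] \<epsilon> by (intro add_pos_pos) auto

lemma trunc_smooth: "trunc \<epsilon> \<in> smooth_off_0"
  unfolding trunc_def[abs_def] power2_eq_square
  by (intro smooth_off_0_divide c_smooth smooth_off_0.intros(1,3,4) smooth_off_0_norm)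
    (use denominator_pos in \<open>simp add: power2_eq_square\<close>)

lemma trunc_pos: "x \<noteq> 0 \<Longrightarrow> 0 < trunc \<epsilon> x"
  unfolding trunc_def by (intro divide_pos_pos c_pos denominator_pos)

lemma trunc_le: "x \<noteq> 0 \<Longrightarrow> trunc \<epsilon> x \<le> 1 / \<epsilon>"
  using denominator_pos[of x] \<epsilon> by (simp add: trunc_def field_simps)

lemma trunc_le_weight: "x \<noteq> 0 \<Longrightarrow> trunc \<epsilon> x \<le> c x / (norm x)\<^sup>2"
  unfolding trunc_def using c_pos[of x] \<epsilon> by (intro divide_left_mono mult_pos_pos denominator_pos) auto

text \<open>The slope of \<open>trunc\<close> is that of w^2 times s = 1/(1 + \<epsilon> w^2), which
  lies in [0,1]. The first bound preserves the constant K. The second controls the zero-order term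
  of the form of q u, through c s^2/r^2 = q s and q <= 1/\<epsilon>.\<close>

lemma trunc_slope_bound:
  assumes x: "x \<noteq> 0"
  shows "\<bar>trunc_slope \<epsilon> x\<bar> \<le> \<bar>log_slope x - 2\<bar>"
    and "c x * (trunc_slope \<epsilon> x)\<^sup>2 / (norm x)\<^sup>2 \<le> (\<delta> + \<delta>' + 2)\<^sup>2 / \<epsilon>"
proof -
  define s where "s = (norm x)\<^sup>2 / ((norm x)\<^sup>2 + \<epsilon> * c x)"
  have s: "0 \<le> s" "s \<le> 1" unfolding s_def
    using denominator_pos[OF x] c_pos[OF x] \<epsilon> by auto
  show "\<bar>trunc_slope \<epsilon> x\<bar> \<le> \<bar>log_slope x - 2\<bar>"
    unfolding trunc_slope_def s_def[symmetric] using s by (simp add: abs_mult mult_left_le)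
  have "c x * (trunc_slope \<epsilon> x)\<^sup>2 / (norm x)\<^sup>2 = (log_slope x - 2)\<^sup>2 * (trunc \<epsilon> x * s)"
    unfolding trunc_slope_def s_def trunc_def using x by (simp add: power2_eq_square)
  also have "\<dots> \<le> (\<delta> + \<delta>' + 2)\<^sup>2 * (1 / \<epsilon> * 1)"
    using s trunc_le[OF x] trunc_pos[OF x] power_mono[OF log_slope_bound[of x] abs_ge_zero, of 2] \<epsilon>
    by (intro mult_mono mult_nonneg_nonneg) auto
  finally show "c x * (trunc_slope \<epsilon> x)\<^sup>2 / (norm x)\<^sup>2 \<le> (\<delta> + \<delta>' + 2)\<^sup>2 / \<epsilon>" by simp
qed

lemma trunc_radial_derivative:
  assumes x: "x \<noteq> 0"
  shows "has_radial_derivative (trunc \<epsilon>) (trunc \<epsilon> x * trunc_slope \<epsilon> x) x"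
proof -
  define g where "g = (norm x)\<^sup>2 + \<epsilon> * c x"
  have g: "g \<noteq> 0" using denominator_pos[OF x] by (simp add: g_def)
  have "has_radial_derivative (\<lambda>x. (norm x)\<^sup>2) (2 * norm x * norm x) x"
    by (rule radial_derivative_compose[OF radial_derivative_norm[OF x]])
      (auto intro!: derivative_eq_intros)
  moreover have "has_radial_derivative (\<lambda>x. \<epsilon> * c x) (\<epsilon> * (c x * log_slope x)) x"
    by (rule radial_derivative_compose[OF c_radial_derivative[OF x]])
      (auto intro!: derivative_eq_intros)
  ultimately have "has_radial_derivative (\<lambda>x. inverse ((norm x)\<^sup>2 + \<epsilon> * c x))
      (- (2 * norm x * norm x + \<epsilon> * (c x * log_slope x)) / g\<^sup>2) x"
    unfolding g_def using g
    by (intro radial_derivative_inverse radial_derivative_add) (auto simp: g_def)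
  from radial_derivative_mult[OF c_radial_derivative[OF x] this]
  have "has_radial_derivative (trunc \<epsilon>) (c x * log_slope x * inverse g
      + c x * (- (2 * norm x * norm x + \<epsilon> * (c x * log_slope x)) / g\<^sup>2)) x"
    by (simp add: trunc_def[abs_def] divide_inverse g_def)
  moreover have "c x * log_slope x * inverse g
      + c x * (- (2 * norm x * norm x + \<epsilon> * (c x * log_slope x)) / g\<^sup>2)
      = trunc \<epsilon> x * trunc_slope \<epsilon> x"
  proof -
    \<comment> \<open>Numerator of the quotient rule: the terms with \<epsilon> c e cancel.\<close>
    have "log_slope x * g - (2 * norm x * norm x + \<epsilon> * (c x * log_slope x))
        = (log_slope x - 2) * (norm x)\<^sup>2"
      by (simp add: g_def power2_eq_square algebra_simps)
    then have "c x * (log_slope x * g - (2 * norm x * norm x + \<epsilon> * (c x * log_slope x))) / g\<^sup>2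
        = trunc \<epsilon> x * trunc_slope \<epsilon> x"
      unfolding trunc_def trunc_slope_def g_def[symmetric] by (simp add: power2_eq_square)
    then show ?thesis using g by (simp add: power2_eq_square field_simps)
  qed
  ultimately show ?thesis by simp
qed

lemma partial_trunc_mult:
  assumes x: "x \<noteq> 0" and u: "u \<in> test_functions_off_0"
  shows "partial b (\<lambda>x. trunc \<epsilon> x * u x) x
    = trunc \<epsilon> x * (partial b u x + trunc_slope \<epsilon> x * u x * (x \<bullet> b) / (norm x)\<^sup>2)"
  using partial_eqI[OF has_derivative_mult[OF trunc_radial_derivative[OF x, unfolded has_radial_derivative_def]
      has_derivative_partial[OF test_differentiable[OF u]]], of b]
  by (simp add: algebra_simps)

text \<open>From |grad(q u)|^2 <= 2 q^2 (|grad u|^2 + \<tau>^2 u^2/r^2) with q^2 <= 1/\<epsilon>^2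
  and c \<tau>^2/r^2 bounded. The constants blow up as \<epsilon> tends to 0, but the bound serves
  only to show, for fixed \<epsilon>, that \<open>q\<close> preserves D(h).\<close>

lemma core_bilinear_trunc_mult_bound:
  assumes u: "u \<in> test_functions_off_0"
  shows "core_bilinear (\<lambda>x. trunc \<epsilon> x * u x) (\<lambda>x. trunc \<epsilon> x * u x)
    \<le> 2 / \<epsilon>\<^sup>2 * core_bilinear u u + 2 * (\<delta> + \<delta>' + 2)\<^sup>2 / \<epsilon> ^ 3 * L2_inner punctured u u"
proof -
  have v: "(\<lambda>x. trunc \<epsilon> x * u x) \<in> test_functions_off_0" by (rule test_smooth_mult[OF trunc_smooth u])
  have int: "integrable (lebesgue_on punctured)
      (\<lambda>x. c x * (\<Sum>b\<in>Basis. partial b f x * partial b f x))" if "f \<in> test_functions_off_0" for f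
    unfolding sum_distrib_left
    by (intro test_integrable test_sum core_bilinear_integrand_test that) auto
  have int_u: "integrable (lebesgue_on punctured) (\<lambda>x. u x * u x)"
    by (intro test_integrable test_test_mult u)
  have "core_bilinear (\<lambda>x. trunc \<epsilon> x * u x) (\<lambda>x. trunc \<epsilon> x * u x)
    \<le> (\<integral>x. 2 / \<epsilon>\<^sup>2 * (c x * (\<Sum>b\<in>Basis. partial b u x * partial b u x))
        + 2 * (\<delta> + \<delta>' + 2)\<^sup>2 / \<epsilon> ^ 3 * (u x * u x) \<partial>(lebesgue_on punctured))"
    unfolding core_bilinear_integral[OF v v]
  proof (rule integral_mono)
    fix x :: 'a assume "x \<in> space (lebesgue_on punctured)"
    then have x: "x \<noteq> 0" by simp
    let ?q = "trunc \<epsilon> x" and ?\<tau> = "trunc_slope \<epsilon> x"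
    have q2: "?q\<^sup>2 \<le> 1 / \<epsilon>\<^sup>2"
      using power_mono[OF trunc_le[OF x] less_imp_le[OF trunc_pos[OF x]], of 2]
      by (simp add: power_divide)
    have sq: "(y + z) * (y + z) \<le> 2 * (y * y) + 2 * (z * z)" for y z :: real
      using sum_squares_bound[of y z] by (simp add: power2_eq_square algebra_simps)
    have "(\<Sum>b\<in>Basis. (partial b u x + ?\<tau> * u x * (x \<bullet> b) / (norm x)\<^sup>2)
          * (partial b u x + ?\<tau> * u x * (x \<bullet> b) / (norm x)\<^sup>2))
        \<le> (\<Sum>b\<in>Basis. 2 * (partial b u x * partial b u x)
          + 2 * ((?\<tau> * u x * (x \<bullet> b) / (norm x)\<^sup>2) * (?\<tau> * u x * (x \<bullet> b) / (norm x)\<^sup>2)))"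
      by (intro sum_mono sq)
    also have "\<dots> = 2 * (\<Sum>b\<in>Basis. partial b u x * partial b u x)
        + 2 * (?\<tau>\<^sup>2 * (u x)\<^sup>2 / ((norm x)\<^sup>2 * (norm x)\<^sup>2)) * (\<Sum>b\<in>Basis. (x \<bullet> b) * (x \<bullet> b))"
      unfolding sum.distrib sum_distrib_left by (simp add: power2_eq_square mult_ac)
    also have "(\<Sum>b\<in>Basis. (x \<bullet> b) * (x \<bullet> b)) = (norm x)\<^sup>2"
      by (simp add: euclidean_inner[symmetric] power2_norm_eq_inner)
    also have "2 * (?\<tau>\<^sup>2 * (u x)\<^sup>2 / ((norm x)\<^sup>2 * (norm x)\<^sup>2)) * (norm x)\<^sup>2
        = 2 * (?\<tau>\<^sup>2 * (u x)\<^sup>2 / (norm x)\<^sup>2)"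
    proof -
      have *: "2 * (a / (R * R)) * R = 2 * (a / R)" if "R \<noteq> 0" for a R :: real using that by simp
      show ?thesis by (rule *) (use x in simp)
    qed
    finally have 1: "(\<Sum>b\<in>Basis. (partial b u x + ?\<tau> * u x * (x \<bullet> b) / (norm x)\<^sup>2)
          * (partial b u x + ?\<tau> * u x * (x \<bullet> b) / (norm x)\<^sup>2))
        \<le> 2 * (\<Sum>b\<in>Basis. partial b u x * partial b u x) + 2 * (?\<tau>\<^sup>2 * (u x)\<^sup>2 / (norm x)\<^sup>2)" .
    have 2: "0 \<le> (\<Sum>b\<in>Basis. (partial b u x + ?\<tau> * u x * (x \<bullet> b) / (norm x)\<^sup>2)
          * (partial b u x + ?\<tau> * u x * (x \<bullet> b) / (norm x)\<^sup>2))"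
      by (rule sum_nonneg) (rule zero_le_square)
    have "c x * (\<Sum>b\<in>Basis. partial b (\<lambda>x. trunc \<epsilon> x * u x) x * partial b (\<lambda>x. trunc \<epsilon> x * u x) x)
        = ?q\<^sup>2 * (c x * (\<Sum>b\<in>Basis. (partial b u x + ?\<tau> * u x * (x \<bullet> b) / (norm x)\<^sup>2)
          * (partial b u x + ?\<tau> * u x * (x \<bullet> b) / (norm x)\<^sup>2)))"
      unfolding partial_trunc_mult[OF x u] sum_distrib_left
      by (intro sum.cong refl) (simp only: power2_eq_square mult_ac)
    also have "\<dots> \<le> 1 / \<epsilon>\<^sup>2 * (c x * (2 * (\<Sum>b\<in>Basis. partial b u x * partial b u x)
        + 2 * (?\<tau>\<^sup>2 * (u x)\<^sup>2 / (norm x)\<^sup>2)))"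
      by (intro mult_mono mult_left_mono q2 1 less_imp_le[OF c_pos[OF x]] mult_nonneg_nonneg[OF _ 2]) simp
    also have "\<dots> = 2 / \<epsilon>\<^sup>2 * (c x * (\<Sum>b\<in>Basis. partial b u x * partial b u x))
        + 2 / \<epsilon>\<^sup>2 * (u x)\<^sup>2 * (c x * ?\<tau>\<^sup>2 / (norm x)\<^sup>2)"
      by (simp add: algebra_simps)
    also have "\<dots> \<le> 2 / \<epsilon>\<^sup>2 * (c x * (\<Sum>b\<in>Basis. partial b u x * partial b u x))
        + 2 / \<epsilon>\<^sup>2 * (u x)\<^sup>2 * ((\<delta> + \<delta>' + 2)\<^sup>2 / \<epsilon>)"
      by (intro add_left_mono mult_left_mono trunc_slope_bound[OF x]) auto
    also have "2 / \<epsilon>\<^sup>2 * (u x)\<^sup>2 * (E\<^sup>2 / \<epsilon>) = 2 * E\<^sup>2 / \<epsilon> ^ 3 * (u x * u x)" for E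
      by (simp add: power2_eq_square power3_eq_cube)
    finally show "c x * (\<Sum>b\<in>Basis. partial b (\<lambda>x. trunc \<epsilon> x * u x) x * partial b (\<lambda>x. trunc \<epsilon> x * u x) x)
        \<le> 2 / \<epsilon>\<^sup>2 * (c x * (\<Sum>b\<in>Basis. partial b u x * partial b u x))
        + 2 * (\<delta> + \<delta>' + 2)\<^sup>2 / \<epsilon> ^ 3 * (u x * u x)" .
  qed (intro Bochner_Integration.integrable_add integrable_mult_right int int_u u v)+
  also have "\<dots> = 2 / \<epsilon>\<^sup>2 * core_bilinear u u + 2 * (\<delta> + \<delta>' + 2)\<^sup>2 / \<epsilon> ^ 3 * L2_inner punctured u u"
    unfolding core_bilinear_integral[OF u u] L2_inner_def using int[OF u] int_u by simp
  finally show ?thesis .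
qed

text \<open>Multiplying the approximating sequence by \<open>q\<close> suffices. The form bound has
  an L2 term, so the Cauchy condition for the products uses both the form Cauchy condition and the
  L2 convergence of the original sequence.\<close>

lemma form_approx_trunc:
  assumes \<Phi>: "form_approx punctured c \<Phi> \<phi>" and \<phi>: "\<phi> \<in> L2_space punctured"
  shows "form_approx punctured c (\<lambda>n x. trunc \<epsilon> x * \<Phi> n x) (\<lambda>x. trunc \<epsilon> x * \<phi> x)"
proof -
  have T: "\<Phi> n \<in> test_functions_off_0" for n using \<Phi> by (auto simp: form_approx_def)
  have D: "(\<lambda>x. \<Phi> n x - \<phi> x) \<in> L2_space punctured" for n
    by (intro L2.diff_closed test_L2 T \<phi>)
  have lim: "(\<lambda>n. L2_norm punctured (\<lambda>x. \<Phi> n x - \<phi> x)) \<longlonglongrightarrow> 0"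
    using \<Phi> by (simp add: form_approx_def)
  have q: "\<bar>trunc \<epsilon> x\<bar> \<le> 1 / \<epsilon>" if "x \<in> punctured" for x
    using that trunc_le[of x] trunc_pos[of x] by auto
  have 1: "(\<lambda>n. L2_norm punctured (\<lambda>x. trunc \<epsilon> x * \<Phi> n x - trunc \<epsilon> x * \<phi> x)) \<longlonglongrightarrow> 0"
  proof (rule Lim_null_comparison[OF always_eventually])
    show "(\<lambda>n. 1 / \<epsilon> * L2_norm punctured (\<lambda>x. \<Phi> n x - \<phi> x)) \<longlonglongrightarrow> 0"
      using tendsto_mult_right_zero[OF lim] .
    show "\<forall>n. norm (L2_norm punctured (\<lambda>x. trunc \<epsilon> x * \<Phi> n x - trunc \<epsilon> x * \<phi> x))
        \<le> 1 / \<epsilon> * L2_norm punctured (\<lambda>x. \<Phi> n x - \<phi> x)"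
    proof
      fix n
      have nn: "0 \<le> L2_norm punctured (\<lambda>x. trunc \<epsilon> x * (\<Phi> n x - \<phi> x))"
        unfolding L2_norm_def
        by (intro real_sqrt_ge_zero L2.B_nonneg L2_bounded_mult[OF D smooth_off_0_measurable[OF trunc_smooth] q])
          (use \<epsilon> in simp_all)
      have "L2_norm punctured (\<lambda>x. trunc \<epsilon> x * (\<Phi> n x - \<phi> x))
          \<le> 1 / \<epsilon> * L2_norm punctured (\<lambda>x. \<Phi> n x - \<phi> x)"
        by (intro L2_norm_bounded_mult[OF D smooth_off_0_measurable[OF trunc_smooth] q])
          (use \<epsilon> in simp_all)
      then show "norm (L2_norm punctured (\<lambda>x. trunc \<epsilon> x * \<Phi> n x - trunc \<epsilon> x * \<phi> x))
          \<le> 1 / \<epsilon> * L2_norm punctured (\<lambda>x. \<Phi> n x - \<phi> x)"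
        using nn by (simp add: right_diff_distrib)
    qed
  qed
  have 2: "\<exists>N. \<forall>m\<ge>N. \<forall>n\<ge>N.
      core_form punctured c (\<lambda>x. trunc \<epsilon> x * \<Phi> m x - trunc \<epsilon> x * \<Phi> n x) < e" if e: "e > 0" for e
  proof -
    define A where "A = 2 / \<epsilon>\<^sup>2"
    define C where "C = 2 * (\<delta> + \<delta>' + 2)\<^sup>2 / \<epsilon> ^ 3"
    have AC: "0 < A" "0 < C"
      using \<epsilon> \<delta>_nonneg by (auto simp: A_def C_def)
    \<comment> \<open>The form and L2 contributions each get e/2. The extra halving pays for
      comparing two terms of the sequence through their common limit.\<close>
    define s where "s = sqrt (e / (2 * C)) / 2"
    have s: "0 < s" using e AC by (simp add: s_def)
    have "0 < e / (2 * A)" using e AC by simp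
    then obtain N where N: "\<And>m n. m \<ge> N \<Longrightarrow> n \<ge> N \<Longrightarrow>
        core_bilinear (\<lambda>x. \<Phi> m x - \<Phi> n x) (\<lambda>x. \<Phi> m x - \<Phi> n x) < e / (2 * A)"
      using \<Phi> unfolding form_approx_def core_form_eq by meson
    obtain M where M: "\<And>n. n \<ge> M \<Longrightarrow> L2_norm punctured (\<lambda>x. \<Phi> n x - \<phi> x) < s"
      using LIMSEQ_D[OF lim s] by fastforce
    have "core_form punctured c (\<lambda>x. trunc \<epsilon> x * \<Phi> m x - trunc \<epsilon> x * \<Phi> n x) < e"
      if mn: "m \<ge> max N M" "n \<ge> max N M" for m n
    proof -
      let ?u = "\<lambda>x. \<Phi> m x - \<Phi> n x"
      have u: "?u \<in> test_functions_off_0" by (intro test_diff T)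
      have "sqrt (L2_inner punctured ?u ?u)
          \<le> L2_norm punctured (\<lambda>x. \<Phi> m x - \<phi> x) + L2_norm punctured (\<lambda>x. \<Phi> n x - \<phi> x)"
        using L2.triangle_diff[OF D[of m] D[of n]] by (simp add: L2_norm_def)
      also have "\<dots> < s + s" using M[of m] M[of n] mn by (intro add_strict_mono) auto
      also have "\<dots> = sqrt (e / (2 * C))" by (simp add: s_def)
      finally have L: "L2_inner punctured ?u ?u < e / (2 * C)" by simp
      have "core_form punctured c (\<lambda>x. trunc \<epsilon> x * \<Phi> m x - trunc \<epsilon> x * \<Phi> n x)
          \<le> A * core_bilinear ?u ?u + C * L2_inner punctured ?u ?u"
        using core_bilinear_trunc_mult_bound[OF u]
        by (simp add: core_form_eq A_def C_def right_diff_distrib)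
      also have "\<dots> < A * (e / (2 * A)) + C * (e / (2 * C))"
        using N[of m n] L mn AC by (intro add_strict_mono mult_strict_left_mono) auto
      also have "\<dots> = e" using AC by simp
      finally show ?thesis .
    qed
    then show ?thesis by blast
  qed
  show ?thesis unfolding form_approx_def using test_smooth_mult[OF trunc_smooth T] 1 2 by auto
qed

end

section \<open>From the inequality on test functions to the operator domain\<close>

definition rellich_root :: real where
  "rellich_root = (real DIM('a) - \<bar>\<delta> - \<delta>'\<bar>) * (real DIM('a) + \<delta> + \<delta>' - 4) / 4"

text \<open>
  Adding the divergence of \<open>\<sigma> c q r\<^sup>-\<^sup>2 u\<^sup>2 x\<close>, with \<open>\<sigma> = (e + d - 2) / 2\<close>, to \<open>c \<nabla>u \<cdot> \<nabla>(qu)\<close>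
  completes the square \<open>c q r\<^sup>-\<^sup>2 (x \<cdot> \<nabla>u + (\<sigma> + \<tau> / 2) u)\<^sup>2\<close>.
\<close>

lemma core_bilinear_trunc_lower_bound:
  assumes \<epsilon>: "0 < \<epsilon>" and u: "u \<in> test_functions_off_0" and s: "4 \<le> \<delta> + \<delta>'" and K0: "0 \<le> rellich_root"
  shows "rellich_root * L2_inner punctured (\<lambda>x. trunc \<epsilon> x * u x) (\<lambda>x. trunc \<epsilon> x * u x)
    \<le> core_bilinear u (\<lambda>x. trunc \<epsilon> x * u x)"
proof -
  let ?q = "trunc \<epsilon>" and ?\<tau> = "trunc_slope \<epsilon>" and ?d = "real DIM('a)"
  define \<sigma> where "\<sigma> x = (log_slope x + ?d - 2) / 2" for x :: 'a
  \<comment> \<open>In terms of r: \<open>\<rho>\<close> is r \<sigma>', \<open>\<kappa>\<close> is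
    r (\<sigma> W)', and \<open>X b\<close> is the component along \<open>b\<close> of the field
    \<sigma> W u^2 x whose divergence is added.\<close>
  define \<rho> where "\<rho> x = (\<delta>' - \<delta>) * (norm x / (1 + norm x) * (1 - norm x / (1 + norm x))) / 2" for x :: 'a
  define W where "W x = c x * ?q x * inverse ((norm x)\<^sup>2)" for x
  define \<kappa> where "\<kappa> x = W x * (\<rho> x + \<sigma> x * (log_slope x + ?\<tau> x - 2))" for x
  define X where "X b x = (x \<bullet> b) * (\<sigma> x * W x) * (u x * u x)" for b x
  have pos: "0 < 1 + norm x" for x :: 'a by (rule add_pos_nonneg) auto
  have v: "(\<lambda>x. ?q x * u x) \<in> test_functions_off_0" by (rule test_smooth_mult[OF trunc_smooth[OF \<epsilon>] u])
  have W_smooth: "W \<in> smooth_off_0"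
  proof (rule smooth_off_0.congr)
    show "(\<lambda>x. c x * ?q x / (norm x * norm x)) \<in> smooth_off_0"
      by (intro smooth_off_0_divide smooth_off_0.mult c_smooth trunc_smooth \<epsilon> smooth_off_0_norm) simp
  qed (simp add: W_def power2_eq_square divide_inverse)
  have \<sigma>_smooth: "\<sigma> \<in> smooth_off_0"
  proof (rule smooth_off_0.congr)
    show "(\<lambda>x::'a. (\<delta> + ?d - 2) / 2 + ((\<delta>' - \<delta>) / 2) * (norm x / (1 + norm x))) \<in> smooth_off_0"
      by (intro smooth_off_0.add smooth_off_0.mult smooth_off_0.const smooth_off_0_divide smooth_off_0_norm)
        (simp add: pos)
    have "(\<delta> + (\<delta>' - \<delta>) * t + ?d - 2) / 2 = (\<delta> + ?d - 2) / 2 + ((\<delta>' - \<delta>) / 2) * t" for t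
      by (simp add: field_simps)
    then show "\<sigma> x = (\<delta> + ?d - 2) / 2 + ((\<delta>' - \<delta>) / 2) * (norm x / (1 + norm x))" for x
      unfolding \<sigma>_def log_slope_def .
  qed
  have X: "X b \<in> test_functions_off_0" for b
    unfolding X_def
    by (intro test_smooth_mult test_test_mult u smooth_off_0.mult smooth_off_0.coord \<sigma>_smooth W_smooth)
  have \<sigma>_deriv: "has_radial_derivative \<sigma> (\<rho> x) x" if x: "x \<noteq> 0" for x
  proof -
    have "DERIV (\<lambda>r. r / (1 + r)) (norm x) :> 1 / (1 + norm x)\<^sup>2"
      using pos[of x] by (auto intro!: derivative_eq_intros simp: power2_eq_square)
    moreover have "DERIV (\<lambda>r. (\<delta> + (\<delta>' - \<delta>) * f r + ?d - 2) / 2) y :> (\<delta>' - \<delta>) * D / 2"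
      if "DERIV f y :> D" for f y D
      using that by (auto intro!: derivative_eq_intros)
    ultimately have "DERIV (\<lambda>r. (\<delta> + (\<delta>' - \<delta>) * (r / (1 + r)) + ?d - 2) / 2) (norm x)
        :> (\<delta>' - \<delta>) * (1 / (1 + norm x)\<^sup>2) / 2" by blast
    from radial_derivative_compose[OF radial_derivative_norm[OF x] this]
    have "has_radial_derivative \<sigma> ((\<delta>' - \<delta>) / (1 + norm x)\<^sup>2 / 2 * norm x) x"
      by (simp add: \<sigma>_def[abs_def] log_slope_def)
    moreover have "1 - norm x / (1 + norm x) = 1 / (1 + norm x)" using pos[of x] by (simp add: field_simps)
    ultimately show ?thesis by (simp add: \<rho>_def power2_eq_square)
  qed
  have W_deriv: "has_radial_derivative W (W x * (log_slope x + ?\<tau> x - 2)) x" if x: "x \<noteq> 0" for x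
  proof -
    have "has_radial_derivative (\<lambda>x. (norm x)\<^sup>2) (2 * norm x * norm x) x"
      by (rule radial_derivative_compose[OF radial_derivative_norm[OF x]])
        (auto intro!: derivative_eq_intros)
    then have "has_radial_derivative (\<lambda>x. inverse ((norm x)\<^sup>2)) (- (2 * norm x * norm x) / ((norm x)\<^sup>2)\<^sup>2) x"
      by (rule radial_derivative_inverse) (use x in simp)
    moreover have "- (2 * norm x * norm x) / ((norm x)\<^sup>2)\<^sup>2 = - 2 * inverse ((norm x)\<^sup>2)"
      using x by (simp add: power2_eq_square field_simps)
    ultimately have "has_radial_derivative (\<lambda>x. inverse ((norm x)\<^sup>2)) (- 2 * inverse ((norm x)\<^sup>2)) x"
      by simp
    from radial_derivative_mult[OF radial_derivative_mult[OF c_radial_derivative[OF x]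
        trunc_radial_derivative[OF \<epsilon> x]] this]
    show ?thesis by (simp add: W_def[abs_def] algebra_simps)
  qed
  have X_deriv: "partial b (X b) x = (\<kappa> x * (x \<bullet> b)\<^sup>2 / (norm x)\<^sup>2 + \<sigma> x * W x) * (u x)\<^sup>2
      + 2 * \<sigma> x * W x * u x * (partial b u x * (x \<bullet> b))" if x: "x \<noteq> 0" and b: "b \<in> Basis" for b x
  proof -
    have "has_radial_derivative (\<lambda>x. \<sigma> x * W x) (\<kappa> x) x"
      using radial_derivative_mult[OF \<sigma>_deriv[OF x] W_deriv[OF x]] by (simp add: \<kappa>_def algebra_simps)
    then have "(X b has_derivative (\<lambda>h. (x \<bullet> b) * (\<sigma> x * W x) * (u x * partial h u x + partial h u x * u x)
        + ((x \<bullet> b) * (\<kappa> x * (x \<bullet> h) / (norm x)\<^sup>2) + (h \<bullet> b) * (\<sigma> x * W x)) * (u x * u x))) (at x)"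
      unfolding X_def has_radial_derivative_def
      by (intro has_derivative_mult has_derivative_inner_left has_derivative_ident
          has_derivative_partial test_differentiable[OF u])
    from partial_eqI[OF this, of b] show ?thesis
      using b by (simp add: power2_eq_square algebra_simps)
  qed
  have i: "integrable (lebesgue_on punctured) (partial b (X b))" if "b \<in> Basis" for b
    by (intro test_integrable test_partial X that)
  have j: "integrable (lebesgue_on punctured) (\<lambda>x. c x * (\<Sum>b\<in>Basis. partial b u x * partial b (\<lambda>x. ?q x * u x) x))"
    unfolding sum_distrib_left
    by (intro test_integrable test_sum core_bilinear_integrand_test u v) auto
  have "rellich_root * L2_inner punctured (\<lambda>x. ?q x * u x) (\<lambda>x. ?q x * u x)
      = (\<integral>x. rellich_root * ((?q x * u x) * (?q x * u x)) \<partial>(lebesgue_on punctured))"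
    by (simp add: L2_inner_def)
  \<comment> \<open>The added divergence has integral 0, so it is free to use, and what remains is a
    pointwise inequality.\<close>
  also have "\<dots> \<le> (\<integral>x. c x * (\<Sum>b\<in>Basis. partial b u x * partial b (\<lambda>x. ?q x * u x) x)
      + (\<Sum>b\<in>Basis. partial b (X b) x) \<partial>(lebesgue_on punctured))"
  proof (rule integral_mono)
    show "integrable (lebesgue_on punctured) (\<lambda>x. rellich_root * ((?q x * u x) * (?q x * u x)))"
      by (intro test_integrable test_scale test_test_mult v)
    show "integrable (lebesgue_on punctured)
        (\<lambda>x. c x * (\<Sum>b\<in>Basis. partial b u x * partial b (\<lambda>x. ?q x * u x) x)
          + (\<Sum>b\<in>Basis. partial b (X b) x))"
      by (intro Bochner_Integration.integrable_add Bochner_Integration.integrable_sum i j)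
    fix x :: 'a assume "x \<in> space (lebesgue_on punctured)"
    then have x: "x \<noteq> 0" by simp
    let ?S = "\<Sum>b\<in>Basis. (partial b u x)\<^sup>2" and ?D = "\<Sum>b\<in>Basis. partial b u x * (x \<bullet> b)"
    have xx: "(\<Sum>b\<in>Basis. (x \<bullet> b)\<^sup>2) = (norm x)\<^sup>2"
      unfolding power2_norm_eq_inner euclidean_inner[of x x] by (simp add: power2_eq_square)
    have W_pos: "0 < W x"
      unfolding W_def using x by (intro mult_pos_pos c_pos trunc_pos \<epsilon>) auto
    \<comment> \<open>Only the radial part of the gradient is kept: |x . grad u|^2 <= |x|^2 |grad
      u|^2.\<close>
    have S: "?D\<^sup>2 \<le> ?S * (norm x)\<^sup>2"
      using Cauchy_Schwarz_ineq_sum[of "\<lambda>b. partial b u x" "\<lambda>b. x \<bullet> b" Basis] by (simp add: xx)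
    have 1: "c x * (\<Sum>b\<in>Basis. partial b u x * partial b (\<lambda>x. ?q x * u x) x)
        = W x * ((norm x)\<^sup>2 * ?S + ?\<tau> x * u x * ?D)"
    proof -
      have "(\<Sum>b\<in>Basis. partial b u x * partial b (\<lambda>x. ?q x * u x) x)
          = ?q x * (?S + ?\<tau> x * u x / (norm x)\<^sup>2 * ?D)"
        unfolding partial_trunc_mult[OF \<epsilon> x u] sum_distrib_left sum.distrib[symmetric]
        by (intro sum.cong refl) (simp add: power2_eq_square field_simps)
      then show ?thesis using x by (simp add: W_def field_simps)
    qed
    have 2: "(\<Sum>b\<in>Basis. partial b (X b) x) = (\<kappa> x + ?d * \<sigma> x * W x) * (u x)\<^sup>2
        + 2 * \<sigma> x * W x * u x * ?D"
    proof -
      have "(\<Sum>b\<in>Basis. partial b (X b) x)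
          = (\<Sum>b\<in>Basis. \<kappa> x / (norm x)\<^sup>2 * (u x)\<^sup>2 * (x \<bullet> b)\<^sup>2 + \<sigma> x * W x * (u x)\<^sup>2
            + 2 * \<sigma> x * W x * u x * (partial b u x * (x \<bullet> b)))"
        by (intro sum.cong refl) (simp add: X_deriv[OF x] algebra_simps)
      also have "\<dots> = \<kappa> x / (norm x)\<^sup>2 * (u x)\<^sup>2 * (norm x)\<^sup>2 + ?d * (\<sigma> x * W x * (u x)\<^sup>2)
            + 2 * \<sigma> x * W x * u x * ?D"
        unfolding sum.distrib sum_distrib_left[symmetric] xx by simp
      finally show ?thesis using x by (simp add: algebra_simps)
    qed
    have K: "rellich_root \<le> (\<sigma> x)\<^sup>2 - (?\<tau> x / 2)\<^sup>2 + \<rho> x"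
    proof -
      have "rellich_root \<le> (\<sigma> x)\<^sup>2 - ((log_slope x - 2) / 2)\<^sup>2 + \<rho> x"
        unfolding rellich_root_def \<sigma>_def \<rho>_def
        by (rule hardy_constant_bound) (use s pos[of x] in \<open>auto simp: log_slope_def Suc_le_eq\<close>)
      moreover have "(?\<tau> x / 2)\<^sup>2 \<le> ((log_slope x - 2) / 2)\<^sup>2"
        using trunc_slope_bound(1)[OF \<epsilon> x] by (simp add: abs_le_square_iff power_divide)
      ultimately show ?thesis by linarith
    qed
    have qW: "(?q x)\<^sup>2 \<le> W x"
      using mult_right_mono[OF trunc_le_weight[OF \<epsilon> x] less_imp_le[OF trunc_pos[OF \<epsilon> x]]]
      by (simp add: W_def power2_eq_square divide_inverse mult_ac)
    have "rellich_root * ((?q x * u x) * (?q x * u x)) = (?q x)\<^sup>2 * (rellich_root * (u x)\<^sup>2)"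
      by (simp add: power2_eq_square)
    \<comment> \<open>Since q <= w^2, q^2 is at most W = q w^2; the sign of
      \<open>rellich_root\<close> lets this pass through the product.\<close>
    also have "\<dots> \<le> W x * (rellich_root * (u x)\<^sup>2)"
      using qW K0 by (intro mult_right_mono) auto
    also have "\<dots> \<le> W x * (((\<sigma> x)\<^sup>2 - (?\<tau> x / 2)\<^sup>2 + \<rho> x) * (u x)\<^sup>2 + (?D + (\<sigma> x + ?\<tau> x / 2) * u x)\<^sup>2)"
      by (intro mult_left_mono order_trans[OF mult_right_mono[OF K]] less_imp_le[OF W_pos]) simp_all
    also have "\<dots> = W x * (?D\<^sup>2 + ?\<tau> x * u x * ?D) + ((\<kappa> x + ?d * \<sigma> x * W x) * (u x)\<^sup>2
        + 2 * \<sigma> x * W x * u x * ?D)"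
    proof -
      \<comment> \<open>The choice of \<sigma> pays off here: substituting for d removes e from the
        coefficient of W u^2, which becomes \<rho> + 2 \<sigma>^2 + \<sigma> \<tau>, exactly what
        expanding the square gives.\<close>
      have d: "?d = 2 * \<sigma> x - log_slope x + 2" by (simp add: \<sigma>_def field_simps)
      show ?thesis unfolding \<kappa>_def d by (simp add: power2_eq_square algebra_simps)
    qed
    also have "\<dots> \<le> W x * ((norm x)\<^sup>2 * ?S + ?\<tau> x * u x * ?D) + ((\<kappa> x + ?d * \<sigma> x * W x) * (u x)\<^sup>2
        + 2 * \<sigma> x * W x * u x * ?D)"
      using S W_pos by (intro add_right_mono mult_left_mono) (auto simp: mult.commute)
    finally show "rellich_root * ((?q x * u x) * (?q x * u x))
        \<le> c x * (\<Sum>b\<in>Basis. partial b u x * partial b (\<lambda>x. ?q x * u x) x) + (\<Sum>b\<in>Basis. partial b (X b) x)"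
      unfolding 1 2 .
  qed
  also have "\<dots> = core_bilinear u (\<lambda>x. ?q x * u x)"
    unfolding core_bilinear_integral[OF u v]
    using i j integral_partial[OF X]
    by (subst Bochner_Integration.integral_add) (auto simp: Bochner_Integration.integral_sum)
  finally show ?thesis .
qed

text \<open>The lower bound passes to the limit along test functions, then q \<phi> is inserted as
  second argument in the defining relation of \<eta>. The resulting bound does not depend on
  \<epsilon>.\<close>

lemma trunc_rellich:
  assumes \<epsilon>: "0 < \<epsilon>" and s: "4 \<le> \<delta> + \<delta>'" and K0: "0 < rellich_root"
    and H: "form_operator_rel punctured c \<phi> \<eta>"
  shows "(\<lambda>x. trunc \<epsilon> x * \<phi> x) \<in> L2_space punctured"
    and "rellich_root * L2_norm punctured (\<lambda>x. trunc \<epsilon> x * \<phi> x) \<le> L2_norm punctured \<eta>"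
proof -
  let ?q = "trunc \<epsilon>"
  have \<phi>: "\<phi> \<in> L2_space punctured" and \<eta>: "\<eta> \<in> L2_space punctured"
    using H by (auto simp: form_operator_rel_def form_dom_def)
  obtain \<Phi> where \<Phi>: "form_approx punctured c \<Phi> \<phi>"
    using H by (auto simp: form_operator_rel_def form_dom_def)
  have T: "\<Phi> n \<in> test_functions_off_0" for n using \<Phi> by (auto simp: form_approx_def)
  have q: "\<bar>?q x\<bar> \<le> 1 / \<epsilon>" if "x \<in> punctured" for x
    using that trunc_le[OF \<epsilon>, of x] trunc_pos[OF \<epsilon>, of x] by auto
  show q\<phi>: "(\<lambda>x. ?q x * \<phi> x) \<in> L2_space punctured"
    by (intro L2_bounded_mult[OF \<phi> smooth_off_0_measurable[OF trunc_smooth[OF \<epsilon>]] q])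
      (use \<epsilon> in simp_all)
  note q\<Phi> = form_approx_trunc[OF \<epsilon> \<Phi> \<phi>]
  have qT: "(\<lambda>x. ?q x * \<Phi> n x) \<in> test_functions_off_0" for n by (rule test_smooth_mult[OF trunc_smooth[OF \<epsilon>] T])
  let ?N = "L2_inner punctured (\<lambda>x. ?q x * \<phi> x) (\<lambda>x. ?q x * \<phi> x)"
  have "(\<lambda>n. L2_inner punctured (\<lambda>x. ?q x * \<Phi> n x) (\<lambda>x. ?q x * \<Phi> n x)) \<longlonglongrightarrow> ?N"
    using q\<Phi> by (intro L2.tendsto_norm[OF test_L2[OF qT] q\<phi> _ tendsto_const])
      (simp add: form_approx_def L2_norm_def)
  then have "(\<lambda>n. rellich_root * L2_inner punctured (\<lambda>x. ?q x * \<Phi> n x) (\<lambda>x. ?q x * \<Phi> n x))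
      \<longlonglongrightarrow> rellich_root * ?N"
    by (intro tendsto_mult_left)
  then have "rellich_root * ?N \<le> closed_bilinear punctured c \<phi> (\<lambda>x. ?q x * \<phi> x)"
    using core_bilinear_trunc_lower_bound[OF \<epsilon> T s less_imp_le[OF K0]]
    by (intro LIMSEQ_le[OF _ closed_bilinear_lim[OF \<Phi> q\<Phi> \<phi> q\<phi>]]) auto
  also have "\<dots> = L2_inner punctured \<eta> (\<lambda>x. ?q x * \<phi> x)"
    using H q\<Phi> q\<phi> by (auto simp: form_operator_rel_def form_dom_def)
  also have "\<dots> \<le> sqrt (L2_inner punctured \<eta> \<eta>) * sqrt ?N"
    using L2.Cauchy_Schwarz[OF \<eta> q\<phi>] by simp
  finally have "rellich_root * ?N \<le> L2_norm punctured \<eta> * sqrt ?N" by (simp add: L2_norm_def)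
  moreover have N: "0 \<le> ?N" by (rule L2.B_nonneg[OF q\<phi>])
  ultimately have *: "(rellich_root * sqrt ?N) * sqrt ?N \<le> L2_norm punctured \<eta> * sqrt ?N"
    by (simp add: mult.assoc)
  show "rellich_root * L2_norm punctured (\<lambda>x. ?q x * \<phi> x) \<le> L2_norm punctured \<eta>"
  \<comment> \<open>Cancelling the norm of q \<phi> requires it to be nonzero; if it is 0 the claim
    is trivial.\<close>
  proof (cases "?N = 0")
    case True
    then show ?thesis using L2.B_nonneg[OF \<eta>] by (simp add: L2_norm_def)
  next
    case False
    then have "0 < sqrt ?N" using N by simp
    then show ?thesis using * by (simp add: L2_norm_def mult_le_cancel_right)
  qed
qed

text \<open>Monotone convergence along \<epsilon> = 1/(n + 1), with the uniform bound on the
  integrals. Membership in L2 has to be stated: the Bochner integral of a non-integrable square is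
  0, and the inequality alone would then say nothing.\<close>

lemma rellich:
  assumes s: "4 \<le> \<delta> + \<delta>'" and K0: "0 < rellich_root"
    and H: "form_operator_rel punctured c \<phi> \<eta>"
  shows "(\<lambda>x. c x / (norm x)\<^sup>2 * \<phi> x) \<in> L2_space punctured"
    and "rellich_root\<^sup>2 * L2_inner punctured (\<lambda>x. c x / (norm x)\<^sup>2 * \<phi> x) (\<lambda>x. c x / (norm x)\<^sup>2 * \<phi> x)
      \<le> L2_inner punctured \<eta> \<eta>"
proof -
  let ?\<epsilon> = "\<lambda>n. inverse (real (Suc n))"
  let ?w = "\<lambda>x. c x / (norm x)\<^sup>2 * \<phi> x"
  define F where "F n x = (trunc (?\<epsilon> n) x * \<phi> x)\<^sup>2" for n x
  have \<epsilon>: "0 < ?\<epsilon> n" for n by simp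
  have \<phi>: "\<phi> \<in> L2_space punctured" and \<eta>: "\<eta> \<in> L2_space punctured"
    using H by (auto simp: form_operator_rel_def form_dom_def)
  have w_smooth: "(\<lambda>x. c x / (norm x)\<^sup>2) \<in> smooth_off_0"
    unfolding power2_eq_square by (intro smooth_off_0_divide c_smooth smooth_off_0.mult smooth_off_0_norm) simp
  have w_meas: "?w \<in> borel_measurable (lebesgue_on punctured)"
    using \<phi> by (intro borel_measurable_times smooth_off_0_measurable[OF w_smooth]) (simp add: L2_space_def)
  have Fint: "integrable (lebesgue_on punctured) (F n)" for n
    using trunc_rellich(1)[OF \<epsilon> s K0 H] by (simp add: L2_space_def F_def[abs_def])
  have Fbound: "rellich_root\<^sup>2 * integral\<^sup>L (lebesgue_on punctured) (F n) \<le> L2_inner punctured \<eta> \<eta>" for n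
  proof -
    have q\<phi>: "(\<lambda>x. trunc (?\<epsilon> n) x * \<phi> x) \<in> L2_space punctured" by (rule trunc_rellich(1)[OF \<epsilon> s K0 H])
    have "(rellich_root * L2_norm punctured (\<lambda>x. trunc (?\<epsilon> n) x * \<phi> x))\<^sup>2 \<le> (L2_norm punctured \<eta>)\<^sup>2"
      using K0 L2.B_nonneg[OF q\<phi>]
      by (intro power_mono trunc_rellich(2)[OF \<epsilon> s K0 H]) (simp add: L2_norm_def)
    moreover have "L2_inner punctured (\<lambda>x. trunc (?\<epsilon> n) x * \<phi> x) (\<lambda>x. trunc (?\<epsilon> n) x * \<phi> x)
        = integral\<^sup>L (lebesgue_on punctured) (F n)"
      unfolding L2_inner_def F_def[abs_def] power2_eq_square ..
    ultimately show ?thesis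
      using L2.B_nonneg[OF q\<phi>] L2.B_nonneg[OF \<eta>] by (simp add: L2_norm_def power_mult_distrib)
  qed
  have mono: "F m x \<le> F n x" if x: "x \<noteq> 0" and mn: "m \<le> n" for m n x
  proof -
    have "trunc (?\<epsilon> m) x \<le> trunc (?\<epsilon> n) x"
      unfolding trunc_def using c_pos[OF x] mn
      by (intro divide_left_mono add_left_mono mult_right_mono mult_pos_pos denominator_pos x \<epsilon>)
        (auto intro: le_imp_inverse_le)
    then have "(trunc (?\<epsilon> m) x)\<^sup>2 \<le> (trunc (?\<epsilon> n) x)\<^sup>2"
      using trunc_pos[OF \<epsilon> x, of m] by (intro power_mono) auto
    then show ?thesis by (simp add: F_def power_mult_distrib mult_right_mono)
  qed
  have lim: "(\<lambda>n. F n x) \<longlonglongrightarrow> (?w x)\<^sup>2" if x: "x \<noteq> 0" for x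
  proof -
    have "(\<lambda>n. (c x / ((norm x)\<^sup>2 + ?\<epsilon> n * c x) * \<phi> x)\<^sup>2) \<longlonglongrightarrow> (c x / ((norm x)\<^sup>2 + 0 * c x) * \<phi> x)\<^sup>2"
      using x by (intro tendsto_intros LIMSEQ_inverse_real_of_nat) auto
    then show ?thesis by (simp add: F_def trunc_def)
  qed
  have "incseq (\<lambda>n. integral\<^sup>L (lebesgue_on punctured) (F n))"
    unfolding incseq_def using mono by (auto intro!: integral_mono Fint)
  moreover have "integral\<^sup>L (lebesgue_on punctured) (F n) \<le> L2_inner punctured \<eta> \<eta> / rellich_root\<^sup>2" for n
    using Fbound[of n] K0 by (simp add: field_simps)
  ultimately obtain I where I: "(\<lambda>n. integral\<^sup>L (lebesgue_on punctured) (F n)) \<longlonglongrightarrow> I"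
    using incseq_convergent by blast
  have AE1: "AE x in lebesgue_on punctured. mono (\<lambda>n. F n x)"
    using mono by (auto intro!: AE_I2 monoI)
  have AE2: "AE x in lebesgue_on punctured. (\<lambda>n. F n x) \<longlonglongrightarrow> (?w x)\<^sup>2"
    using lim by (auto intro!: AE_I2)
  have meas: "(\<lambda>x. (?w x)\<^sup>2) \<in> borel_measurable (lebesgue_on punctured)"
    using w_meas by (rule borel_measurable_power)
  have wi: "integrable (lebesgue_on punctured) (\<lambda>x. (?w x)\<^sup>2)"
    by (rule integrable_monotone_convergence[OF Fint AE1 AE2 I meas])
  show "?w \<in> L2_space punctured" using wi w_meas by (simp add: L2_space_def)
  have "integral\<^sup>L (lebesgue_on punctured) (\<lambda>x. (?w x)\<^sup>2) = I"
    by (rule integral_monotone_convergence[OF Fint AE1 AE2 I meas])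
  then have "L2_inner punctured ?w ?w = I" by (simp add: L2_inner_def power2_eq_square)
  moreover have "rellich_root\<^sup>2 * I \<le> L2_inner punctured \<eta> \<eta>"
    by (rule LIMSEQ_le_const2[OF tendsto_mult_left[OF I]]) (use Fbound in auto)
  ultimately show "rellich_root\<^sup>2 * L2_inner punctured ?w ?w \<le> L2_inner punctured \<eta> \<eta>" by simp
qed

end

theorem mainTheorem13:
  fixes \<Omega> :: "(real ^ 'n) set"
    and \<delta> \<delta>' d a\<^sub>2 :: real
    and c :: "real \<Rightarrow> real"
    and c\<^sub>\<Omega> d\<^sub>\<Omega> :: "real ^ 'n \<Rightarrow> real"
    and H :: "(real ^ 'n \<Rightarrow> real) \<Rightarrow> (real ^ 'n \<Rightarrow> real)"
  assumes "\<Omega> = UNIV - {0}"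
    and "d = real CARD('n)"
    and "\<And>x. d\<^sub>\<Omega> x = infdist x (frontier \<Omega>)"
    and "\<delta> \<ge> 0" and "\<delta>' \<ge> 0"
    and "\<And>s. s > 0 \<Longrightarrow> c s = s powr \<delta> * (1 + s) powr (\<delta>' - \<delta>)"
    and "\<And>x. c\<^sub>\<Omega> x = c (norm x)"
    and "H = form_operator \<Omega> c\<^sub>\<Omega>"
    and "\<delta> + \<delta>' \<ge> 4"
    and "d - \<bar>\<delta> - \<delta>'\<bar> > 0"
    and "a\<^sub>2 = (d - \<bar>\<delta> - \<delta>'\<bar>)\<^sup>2 * (d + \<delta> + \<delta>' - 4)\<^sup>2 / 16"
  shows "\<forall>\<phi> \<in> form_operator_dom \<Omega> c\<^sub>\<Omega>.
    (\<lambda>x. c\<^sub>\<Omega> x / (d\<^sub>\<Omega> x)\<^sup>2 * \<phi> x) \<in> L2_space \<Omega> \<and>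
    L2_inner \<Omega> (H \<phi>) (H \<phi>)
      \<ge> a\<^sub>2 * L2_inner \<Omega> (\<lambda>x. c\<^sub>\<Omega> x / (d\<^sub>\<Omega> x)\<^sup>2 * \<phi> x) (\<lambda>x. c\<^sub>\<Omega> x / (d\<^sub>\<Omega> x)\<^sup>2 * \<phi> x)"
proof
  interpret radial_weight \<delta> \<delta>' c\<^sub>\<Omega>
    using assms(4,5,6,7) by unfold_locales auto
  \<comment> \<open>The boundary of the punctured space is the origin, so the distance to it is the
    norm.\<close>
  have "frontier \<Omega> = {0}"
    using frontier_complement[of "{0 :: real ^ 'n}"]
    by (simp add: assms(1) Compl_eq_Diff_UNIV[symmetric] frontier_def)
  then have d: "d\<^sub>\<Omega> x = norm x" for x by (simp add: assms(3))
  \<comment> \<open>With d >= 1 and \<delta> + \<delta>' >= 4 the second factor of K is positive, so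
    the sign of K is that of d - |\<delta> - \<delta>'|.\<close>
  have d_pos: "0 < d + \<delta> + \<delta>' - 4" using assms(2,9) zero_less_card_finite[where 'a = 'n] by linarith
  have K0: "0 < rellich_root" and K: "a\<^sub>2 = rellich_root\<^sup>2"
    using d_pos assms(2,10,11) by (simp_all add: rellich_root_def power_mult_distrib power_divide)
  fix \<phi> assume "\<phi> \<in> form_operator_dom \<Omega> c\<^sub>\<Omega>"
  \<comment> \<open>On the operator domain the choice made by \<open>SOME\<close> does satisfy the
    relation, and \<open>rellich\<close> applies to any such representative.\<close>
  then have "form_operator_rel \<Omega> c\<^sub>\<Omega> \<phi> (H \<phi>)"
    unfolding form_operator_dom_def assms(8) form_operator_def 
    by (auto intro: someI[of "form_operator_rel \<Omega> c\<^sub>\<Omega> \<phi>"])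
  then have "form_operator_rel punctured c\<^sub>\<Omega> \<phi> (H \<phi>)" by (simp add: assms(1))
  from rellich[OF assms(9) K0 this]
  show "(\<lambda>x. c\<^sub>\<Omega> x / (d\<^sub>\<Omega> x)\<^sup>2 * \<phi> x) \<in> L2_space \<Omega> \<and>
    L2_inner \<Omega> (H \<phi>) (H \<phi>)
      \<ge> a\<^sub>2 * L2_inner \<Omega> (\<lambda>x. c\<^sub>\<Omega> x / (d\<^sub>\<Omega> x)\<^sup>2 * \<phi> x) (\<lambda>x. c\<^sub>\<Omega> x / (d\<^sub>\<Omega> x)\<^sup>2 * \<phi> x)"
    by (simp add: d K assms(1))
qed

end
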